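(* Let $\varphi:\mathbb{R}\to\mathbb{R}$ be a smooth function such that $\varphi$ is monotone, $\dddot{\varphi}\,\dot{\varphi}\ge 0$ and $\ddot{\varphi}\le 0$ on $\mathbb{R}$. Let $\Sigma$ be a complete $[\varphi,\vec{e}_3]$-minimal surface in $\mathbb{R}^3$ with bounded mean curvature $H$ and Gauss curvature $K\ge 0$. Suppose that there is a constant $C>0$ such that $$\langle p,\vec{e}_3\rangle\,|\dot{\varphi}(\langle p,\vec{e}_3\rangle)|\le C|p|\qquad\text{as } p\to\infty \text{ on } \Sigma,$$ and that there are a constant $\varepsilon>0$ and a vector $y_0\in\mathbb{S}^2$ with $\langle y_0,\vec{e}_3\rangle=0$ such that the Gauss map $N:\Sigma\to\mathbb{S}^2$ satisfies $$\langle N,y_0\rangle\le -2\varepsilon\qquad\text{on }\Sigma.$$ Then $\Sigma$ is a plane.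
   Context: $\langle\cdot,\cdot\rangle$ is the Euclidean metric of $\mathbb{R}^3$, $|p|$ is the Euclidean distance from $p$ to the origin, and $\vec{e}_3=(0,0,1)$. A dot denotes the derivative of $\varphi$ with respect to its real variable (the third coordinate); at a point $p$ of a surface, $\varphi$ and its derivatives are evaluated at $\langle p,\vec{e}_3\rangle$. An inequality "as $p\to\infty$ on $\Sigma$" means that it holds for all $p\in\Sigma$ with $|p|$ sufficiently large. Surfaces are smooth, connected, without boundary, isometrically immersed and oriented by a unit normal $N:\Sigma\to\mathbb{S}^2$ (the Gauss map); complete means complete in the induced metric. A surface $\Sigma$ in $\mathbb{R}^3$ is $[\varphi,\vec{e}_3]$-minimal if it is a critical point of the weighted area functional $\int_\Sigma e^{\varphi}\,d\Sigma$, where $\varphi$ on $\Sigma$ means $p\mapsto\varphi(\langle p,\vec{e}_3\rangle)$; equivalently, its mean curvature vector $\mathbf{H}$ (the trace of the vector-valued second fundamental form) satisfies $\mathbf{H}=\dot{\varphi}\,\vec{e}_3^{\,\perp}$, where $\perp$ is the projection onto the normal bundle. $H$ is the corresponding scalar mean curvature, i.e. the sum of the principal curvatures (so $|H|=|\mathbf{H}|$), and $K$ is the Gauss curvature. *)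

theory Defs
  imports "HOL-Analysis.Analysis"
begin

text \<open>
  Meaningful for open \<open>S\<close> only, since two-sided derivatives are used.
\<close>

primrec Ck_on :: "nat \<Rightarrow> 'a::euclidean_space set \<Rightarrow> ('a \<Rightarrow> 'b::real_normed_vector) \<Rightarrow> bool" where
  "Ck_on 0 S f \<longleftrightarrow> continuous_on S f"
| "Ck_on (Suc k) S f \<longleftrightarrow> (\<forall>x\<in>S. f differentiable (at x)) \<and>
     (\<forall>v. Ck_on k S (\<lambda>x. frechet_derivative f (at x) v))"

definition smooth_on :: "'a::euclidean_space set \<Rightarrow> ('a \<Rightarrow> 'b::real_normed_vector) \<Rightarrow> bool" where
  "smooth_on S f \<longleftrightarrow> (\<forall>k. Ck_on k S f)"

abbreviation e3 :: "real^3" where "e3 \<equiv> axis 3 1"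

text \<open>
  An abstract surface is the type \<open>'m\<close> (Hausdorff and second countable by its sort) together
  with an atlas of local parametrizations \<open>(U, \<psi>)\<close>, i.e. inverses of charts: \<open>\<psi>\<close> is a
  homeomorphism from the open set \<open>U\<close> of the plane onto an open subset of the surface. The
  values of \<open>\<psi>\<close> outside \<open>U\<close> are irrelevant.
\<close>

type_synonym 'm atlas = "((real^2) set \<times> (real^2 \<Rightarrow> 'm)) set"

definition smooth_surface :: "'m::{t2_space,second_countable_topology} atlas \<Rightarrow> bool" where
  "smooth_surface A \<longleftrightarrow>
     (\<forall>(U,\<psi>)\<in>A. open U \<and> open (\<psi> ` U) \<and> homeomorphism U (\<psi> ` U) \<psi> (inv_into U \<psi>)) \<and>
     (\<Union>(U,\<psi>)\<in>A. \<psi> ` U) = UNIV \<and>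
     (\<forall>(U,\<psi>)\<in>A. \<forall>(V,\<eta>)\<in>A. smooth_on {u\<in>U. \<psi> u \<in> \<eta> ` V} (\<lambda>u. inv_into V \<eta> (\<psi> u)))"

definition smooth_map :: "'m atlas \<Rightarrow> ('m \<Rightarrow> real^3) \<Rightarrow> bool" where
  "smooth_map A F \<longleftrightarrow> (\<forall>(U,\<psi>)\<in>A. smooth_on U (F \<circ> \<psi>))"

definition immersion :: "'m atlas \<Rightarrow> ('m \<Rightarrow> real^3) \<Rightarrow> bool" where
  "immersion A X \<longleftrightarrow> smooth_map A X \<and>
     (\<forall>(U,\<psi>)\<in>A. \<forall>u\<in>U. inj (frechet_derivative (X \<circ> \<psi>) (at u)))"

definition unit_normal :: "'m atlas \<Rightarrow> ('m \<Rightarrow> real^3) \<Rightarrow> ('m \<Rightarrow> real^3) \<Rightarrow> bool" where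
  "unit_normal A X N \<longleftrightarrow> smooth_map A N \<and> (\<forall>p. norm (N p) = 1) \<and>
     (\<forall>(U,\<psi>)\<in>A. \<forall>u\<in>U. \<forall>v. frechet_derivative (X \<circ> \<psi>) (at u) v \<bullet> N (\<psi> u) = 0)"

definition oriented_immersed_surface ::
    "'m::{t2_space,second_countable_topology} atlas \<Rightarrow> ('m \<Rightarrow> real^3) \<Rightarrow> ('m \<Rightarrow> real^3) \<Rightarrow> bool" where
  "oriented_immersed_surface A X N \<longleftrightarrow>
     smooth_surface A \<and> connected (UNIV :: 'm set) \<and> immersion A X \<and> unit_normal A X N"

text \<open>
  Since \<open>X\<close> is an immersion, a continuous curve \<open>\<gamma>\<close> in the surface is piecewise \<open>C\<^sup>1\<close>
  iff \<open>X \<circ> \<gamma>\<close> is. As \<open>valid_path\<close> does not bound the velocity near the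
  exceptional parameters, the \<open>has_integral\<close> clause is what excludes non-rectifiable curves
  (whose \<open>integral\<close> would be the default value 0).
\<close>

definition induced_dist :: "('m::topological_space \<Rightarrow> real^3) \<Rightarrow> 'm \<Rightarrow> 'm \<Rightarrow> real" where
  "induced_dist X p q = Inf {L. \<exists>\<gamma>. path \<gamma> \<and> pathstart \<gamma> = p \<and> pathfinish \<gamma> = q \<and>
     valid_path (X \<circ> \<gamma>) \<and>
     ((\<lambda>t. norm (vector_derivative (X \<circ> \<gamma>) (at t))) has_integral L) {0..1}}"

definition complete_surface :: "('m::topological_space \<Rightarrow> real^3) \<Rightarrow> bool" where
  "complete_surface X \<longleftrightarrow>
     (\<forall>s :: nat \<Rightarrow> 'm.
        (\<forall>e>0. \<exists>k. \<forall>m\<ge>k. \<forall>n\<ge>k. induced_dist X (s m) (s n) < e) \<longrightarrow>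
        (\<exists>l. (\<lambda>n. induced_dist X (s n) l) \<longlonglongrightarrow> 0))"

text \<open>
  In the following, \<open>r = X \<circ> \<psi>\<close> is a parametrized piece of the surface and
  \<open>\<nu> = N \<circ> \<psi>\<close> its unit normal.
\<close>

definition pd :: "2 \<Rightarrow> (real^2 \<Rightarrow> 'b::real_normed_vector) \<Rightarrow> real^2 \<Rightarrow> 'b" where
  "pd i f u = frechet_derivative f (at u) (axis i 1)"

definition first_form :: "(real^2 \<Rightarrow> real^3) \<Rightarrow> real^2 \<Rightarrow> real^2^2" where
  "first_form r u = (\<chi> i j. pd i r u \<bullet> pd j r u)"

definition normal_part :: "real^3 \<Rightarrow> real^3 \<Rightarrow> real^3" where
  "normal_part n v = (v \<bullet> n) *\<^sub>R n"

definition vector_second_form ::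
    "(real^2 \<Rightarrow> real^3) \<Rightarrow> (real^2 \<Rightarrow> real^3) \<Rightarrow> real^2 \<Rightarrow> 2 \<Rightarrow> 2 \<Rightarrow> real^3" where
  "vector_second_form r \<nu> u i j = normal_part (\<nu> u) (pd i (pd j r) u)"

definition mean_curvature_vector ::
    "(real^2 \<Rightarrow> real^3) \<Rightarrow> (real^2 \<Rightarrow> real^3) \<Rightarrow> real^2 \<Rightarrow> real^3" where
  "mean_curvature_vector r \<nu> u =
     (\<Sum>i\<in>UNIV. \<Sum>j\<in>UNIV. matrix_inv (first_form r u) $ i $ j *\<^sub>R vector_second_form r \<nu> u j i)"

definition second_form :: "(real^2 \<Rightarrow> real^3) \<Rightarrow> (real^2 \<Rightarrow> real^3) \<Rightarrow> real^2 \<Rightarrow> real^2^2" where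
  "second_form r \<nu> u = (\<chi> i j. vector_second_form r \<nu> u i j \<bullet> \<nu> u)"

text \<open>
  The matrix of the shape operator in the coordinate basis; its eigenvalues are the
  principal curvatures.
\<close>

definition shape_matrix :: "(real^2 \<Rightarrow> real^3) \<Rightarrow> (real^2 \<Rightarrow> real^3) \<Rightarrow> real^2 \<Rightarrow> real^2^2" where
  "shape_matrix r \<nu> u = matrix_inv (first_form r u) ** second_form r \<nu> u"

definition mean_curvature :: "(real^2 \<Rightarrow> real^3) \<Rightarrow> (real^2 \<Rightarrow> real^3) \<Rightarrow> real^2 \<Rightarrow> real" where
  "mean_curvature r \<nu> u = trace (shape_matrix r \<nu> u)"

definition gauss_curvature :: "(real^2 \<Rightarrow> real^3) \<Rightarrow> (real^2 \<Rightarrow> real^3) \<Rightarrow> real^2 \<Rightarrow> real" where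
  "gauss_curvature r \<nu> u = det (shape_matrix r \<nu> u)"

definition phi_minimal ::
    "(real \<Rightarrow> real) \<Rightarrow> 'm atlas \<Rightarrow> ('m \<Rightarrow> real^3) \<Rightarrow> ('m \<Rightarrow> real^3) \<Rightarrow> bool" where
  "phi_minimal \<phi> A X N \<longleftrightarrow>
     (\<forall>(U,\<psi>)\<in>A. \<forall>u\<in>U. mean_curvature_vector (X \<circ> \<psi>) (N \<circ> \<psi>) u =
        deriv \<phi> (X (\<psi> u) \<bullet> e3) *\<^sub>R normal_part (N (\<psi> u)) e3)"

lemma mean_curvature_vector_eq:
  assumes "norm (\<nu> u) = 1"
  shows "mean_curvature_vector r \<nu> u = mean_curvature r \<nu> u *\<^sub>R \<nu> u"
proof -
  have n: "\<nu> u \<bullet> \<nu> u = 1"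
    using assms by (simp add: norm_eq_1)
  have s: "vector_second_form r \<nu> u i j = second_form r \<nu> u $ i $ j *\<^sub>R \<nu> u" for i j
    by (simp add: second_form_def vector_second_form_def normal_part_def n)
  show ?thesis
    unfolding mean_curvature_vector_def mean_curvature_def trace_def shape_matrix_def
    by (simp add: s matrix_matrix_mult_def scaleR_sum_left)
qed

end

theory Submission
  imports Defs
begin

text \<open>
  Let \<open>Q\<close> be the projection along \<open>y0\<close> onto the vertical plane orthogonal to it. The Gauss map
  condition says that \<open>Q\<close> stretches tangent vectors by at least \<open>2\<epsilon>\<close>, so \<open>Q \<circ> X\<close> is a local
  diffeomorphism, and by completeness segments of the plane lift. Hence \<open>Q \<circ> X\<close> is bijective and
  the surface is the entire graph of a function \<open>u\<close> with bounded gradient \<open>(a, b)\<close>, where \<open>b\<close> is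
  the derivative in the direction of \<open>e3\<close>. Now \<open>K \<ge> 0\<close> says that the Hessian of \<open>u\<close> is
  semidefinite, and minimality that its trace with respect to the inverse metric is
  \<open>-\<phi>' b\<close>, \<open>\<phi>'\<close> being evaluated at the height.

  A semidefinite matrix is bounded by its trace, so \<open>\<bar>grad b\<bar> \<le> const \<bar>\<phi>' b\<bar>\<close>: if \<open>b\<close> vanishes
  somewhere, it vanishes everywhere and the Hessian is zero. Otherwise \<open>u\<close> is convex up to sign.
  In the vertical direction in which \<open>\<bar>\<phi>'\<bar>\<close> grows, so does \<open>\<bar>b\<bar>\<close>, by monotonicity of the
  gradient, up to an error that vanishes far away. So there are arbitrarily large discs on which
  the Laplacian of \<open>u\<close> is bounded away from zero, which is impossible for a Lipschitz function.
\<close>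

subsection \<open>Maps with local sections\<close>

text \<open>Openness of the image turns a right inverse into a local inverse: \<open>F\<close> is
  injective on that image, which is a neighbourhood of \<open>p\<close>.\<close>

definition local_section :: "('m::topological_space \<Rightarrow> 'b::metric_space) \<Rightarrow> 'm \<Rightarrow> ('b \<Rightarrow> 'm) \<Rightarrow> real \<Rightarrow> bool" where
  "local_section F p g d \<longleftrightarrow> 0 < d \<and> continuous_on (ball (F p) d) g \<and> g (F p) = p \<and>
     (\<forall>y\<in>ball (F p) d. F (g y) = y) \<and> open (g ` ball (F p) d)"

locale locally_sectioned =
  fixes F :: "'m::t2_space \<Rightarrow> 'b::euclidean_space"
  assumes ex_local_section: "\<exists>g d. local_section F p g d"
begin

lemma locally_inj: "\<exists>W. open W \<and> p \<in> W \<and> inj_on F W"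
proof -
  obtain g d where "local_section F p g d" using ex_local_section by blast
  then have "open (g ` ball (F p) d)" "p \<in> g ` ball (F p) d" "inj_on F (g ` ball (F p) d)"
    unfolding local_section_def by (auto simp: inj_on_def image_iff intro: bexI[of _ "F p"])
  then show ?thesis by blast
qed

text \<open>Uniqueness of lifts. The coincidence set is open because \<open>F\<close> is injective
  near a common value, and relatively closed because lifts take values in a Hausdorff space.\<close>

lemma lifts_agree:
  fixes f g :: "'a::topological_space \<Rightarrow> 'm"
  assumes S: "connected S" and f: "continuous_on S f" and g: "continuous_on S g"
    and eq: "\<And>y. y \<in> S \<Longrightarrow> F (f y) = F (g y)"
    and a: "a \<in> S" "f a = g a" and y: "y \<in> S"
  shows "f y = g y"
proof -
  let ?E = "{y \<in> S. f y = g y}"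
  have "openin (top_of_set S) ?E"
  proof (subst openin_subopen, intro ballI)
    fix x assume x: "x \<in> ?E"
    obtain W where W: "open W" "f x \<in> W" "inj_on F W" using locally_inj by blast
    let ?T = "(S \<inter> f -` W) \<inter> (S \<inter> g -` W)"
    have "openin (top_of_set S) ?T"
      by (intro openin_Int continuous_openin_preimage_gen f g W)
    moreover have "x \<in> ?T" using x W by auto
    moreover have "?T \<subseteq> ?E" using W(3) eq by (auto simp: inj_on_def)
    ultimately show "\<exists>T. openin (top_of_set S) T \<and> x \<in> T \<and> T \<subseteq> ?E" by blast
  qed
  moreover have "openin (top_of_set S) (S - ?E)"
  proof (subst openin_subopen, intro ballI)
    fix x assume x: "x \<in> S - ?E"
    then have "f x \<noteq> g x" by auto
    from hausdorff[OF this] obtain U V where UV: "open U" "open V" "f x \<in> U" "g x \<in> V" "U \<inter> V = {}"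
      by blast
    let ?T = "(S \<inter> f -` U) \<inter> (S \<inter> g -` V)"
    have "openin (top_of_set S) ?T"
      by (intro openin_Int continuous_openin_preimage_gen f g UV)
    moreover have "x \<in> ?T" using x UV by auto
    moreover have "?T \<subseteq> S - ?E" using UV(5) by (auto simp: disjoint_iff)
    ultimately show "\<exists>T. openin (top_of_set S) T \<and> x \<in> T \<and> T \<subseteq> S - ?E" by blast
  qed
  then have "closedin (top_of_set S) ?E"
    by (simp add: closedin_def)
  ultimately have "?E = {} \<or> ?E = S" using S unfolding connected_clopen by blast
  then show ?thesis using a y by blast
qed

text \<open>Sections over convex open neighbourhoods of \<open>F p\<close> agree on overlaps, which
  are connected, so they glue to one section over the union of these neighbourhoods. If the union
  missed a point, \<open>lift\<close> would carry the section past the first missing point of a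
  segment starting at \<open>F p\<close>. Completeness of the surface enters only through
  \<open>lift\<close>.\<close>

lemma global_section:
  assumes lift: "\<And>\<sigma> a b \<tau>. 0 < \<tau> \<Longrightarrow> continuous_on {0..<\<tau>} \<sigma> \<Longrightarrow>
      (\<forall>t\<in>{0..<\<tau>}. F (\<sigma> t) = a + t *\<^sub>R (b - a)) \<Longrightarrow>
      \<exists>l g d t. local_section F l g d \<and> F l = a + \<tau> *\<^sub>R (b - a) \<and> t \<in> {0..<\<tau>} \<and>
        a + t *\<^sub>R (b - a) \<in> ball (F l) d \<and> \<sigma> t = g (a + t *\<^sub>R (b - a))"
  shows "\<exists>s. continuous_on UNIV s \<and> (\<forall>y. F (s y) = y) \<and> s (F p) = p"
proof -
  define c where "c = F p"
  define good where "good = (\<lambda>V G. open V \<and> convex V \<and> c \<in> V \<and> continuous_on V G \<and>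
     (\<forall>y\<in>V. F (G y) = y) \<and> G c = p)"
  have agree: "G y = G' y" if "good V G" "good V' G'" "y \<in> V" "y \<in> V'" for V G V' G' y
  proof (rule lifts_agree[of "V \<inter> V'" G G' c])
    show "connected (V \<inter> V')" using that by (auto simp: good_def intro: convex_connected convex_Int)
    show "continuous_on (V \<inter> V') G" "continuous_on (V \<inter> V') G'"
      using that by (auto simp: good_def intro: continuous_on_subset)
  qed (use that in \<open>auto simp: good_def\<close>)
  define \<Omega> where "\<Omega> = \<Union>{V. \<exists>G. good V G}"
  define s where "s = (\<lambda>y. THE q. \<exists>V G. good V G \<and> y \<in> V \<and> q = G y)"
  have s: "s y = G y" if "good V G" "y \<in> V" for V G y
    unfolding s_def using that agree by (intro the_equality) blast+
  have [simp]: "open \<Omega>" by (auto simp: \<Omega>_def good_def)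
  have F_s: "F (s y) = y" if "y \<in> \<Omega>" for y
  proof -
    obtain V G where "good V G" "y \<in> V" using \<open>y \<in> \<Omega>\<close> by (auto simp: \<Omega>_def)
    then show ?thesis using s by (auto simp: good_def)
  qed
  have cont_s: "continuous_on \<Omega> s"
  proof -
    have "isCont s y" if "y \<in> \<Omega>" for y
    proof -
      obtain V G where V: "good V G" "y \<in> V" using \<open>y \<in> \<Omega>\<close> by (auto simp: \<Omega>_def)
      then have "continuous_on V s \<longleftrightarrow> continuous_on V G" using s by (intro continuous_on_cong) auto
      then show ?thesis using V by (auto simp: good_def continuous_on_eq_continuous_at)
    qed
    then show ?thesis by (simp add: continuous_on_eq_continuous_at)
  qed
  obtain g0 d0 where g0: "local_section F p g0 d0" using ex_local_section by blast
  then have good0: "good (ball c d0) g0" by (auto simp: good_def local_section_def c_def)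
  then have "c \<in> ball c d0" by (auto simp: good_def)
  then have c\<Omega>: "c \<in> \<Omega>" using good0 unfolding \<Omega>_def by blast
  have sc: "s c = p" using s[OF good0] good0 by (auto simp: good_def)
  have "y \<in> \<Omega>" for y
  proof (rule ccontr)
    assume y: "y \<notin> \<Omega>"
    define h where "h = (\<lambda>t::real. c + t *\<^sub>R (y - c))"
    have h[continuous_intros]: "continuous_on T h" for T
      unfolding h_def by (intro continuous_intros)
    define B where "B = {t \<in> {0..1}. h t \<notin> \<Omega>}"
    have "closed B"
    proof -
      have "B = {0..1} \<inter> h -` (- \<Omega>)" by (auto simp: B_def)
      moreover have "closed ({0..1} \<inter> h -` (- \<Omega>))"
        by (intro continuous_closed_preimage h) auto
      ultimately show ?thesis by simp
    qed
    have "1 \<in> B" using y by (simp add: B_def h_def)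
    have bdd: "bdd_below B" by (rule bdd_belowI[of _ 0]) (auto simp: B_def)
    \<comment> \<open>The first parameter at which the segment from \<open>c\<close> to
      \<open>y\<close> leaves \<open>\<Omega>\<close>. It lies in \<open>B\<close> because
      \<open>\<Omega>\<close> is open.\<close>
    define \<tau> where "\<tau> = Inf B"
    have \<tau>B: "\<tau> \<in> B" unfolding \<tau>_def using closed_contains_Inf[OF _ bdd \<open>closed B\<close>] \<open>1 \<in> B\<close> by blast
    have "\<tau> \<noteq> 0" using \<tau>B c\<Omega> by (auto simp: B_def h_def)
    then have \<tau>0: "0 < \<tau>" "\<tau> \<le> 1" using \<tau>B by (auto simp: B_def)
    have below: "h t \<in> \<Omega>" if "t \<in> {0..<\<tau>}" for t
    proof (rule ccontr)
      assume "h t \<notin> \<Omega>"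
      then have "t \<in> B" using that \<tau>0 by (auto simp: B_def)
      then have "\<tau> \<le> t" unfolding \<tau>_def using bdd by (intro cInf_lower)
      then show False using that by auto
    qed
    have "continuous_on {0..<\<tau>} (\<lambda>t. s (h t))"
      by (rule continuous_on_compose2[OF cont_s h]) (use below in auto)
    then obtain l g d t where l: "local_section F l g d" "F l = h \<tau>" "t \<in> {0..<\<tau>}"
        "h t \<in> ball (F l) d" "s (h t) = g (h t)"
      using lift[of \<tau> "\<lambda>t. s (h t)" c y] F_s below \<tau>0 unfolding h_def by auto
    obtain V G where V: "good V G" "h t \<in> V" using below[OF l(3)] unfolding \<Omega>_def by blast
    have V': "open V" "convex V" "c \<in> V" "continuous_on V G" "\<And>y. y \<in> V \<Longrightarrow> F (G y) = y" "G c = p"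
      using V by (auto simp: good_def)
    let ?B = "ball (h \<tau>) d"
    have g: "continuous_on ?B g" "\<And>y. y \<in> ?B \<Longrightarrow> F (g y) = y" "0 < d"
      using l by (auto simp: local_section_def)
    have eqG: "G z = g z" if "z \<in> V" "z \<in> ?B" for z
    proof (rule lifts_agree[of "V \<inter> ?B" G g "h t"])
      show "connected (V \<inter> ?B)" using V' by (intro convex_connected convex_Int) auto
      show "continuous_on (V \<inter> ?B) G" "continuous_on (V \<inter> ?B) g"
        using V' g by (auto intro: continuous_on_subset)
      show "G (h t) = g (h t)" using l s[OF V] by simp
    qed (use that V V' g l in auto)
    define K where "K = closed_segment c (h \<tau>)"
    have "K \<subseteq> V \<union> ?B"
    proof -
      have "h t \<in> K" unfolding K_def in_segment h_def using l(3) \<tau>0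
        by (intro exI[of _ "t / \<tau>"]) (auto simp: algebra_simps)
      then have "K = closed_segment c (h t) \<union> closed_segment (h t) (h \<tau>)"
        unfolding K_def by (rule Un_closed_segment[symmetric])
      moreover have "closed_segment c (h t) \<subseteq> V"
        using V V' by (intro closed_segment_subset) auto
      moreover have "closed_segment (h t) (h \<tau>) \<subseteq> ?B"
        using l g by (intro closed_segment_subset) auto
      ultimately show ?thesis by blast
    qed
    moreover have "compact K" by (simp add: K_def)
    ultimately obtain e where e: "0 < e" "(\<Union>x\<in>K. ball x e) \<subseteq> V \<union> ?B"
      using compact_subset_open_imp_ball_epsilon_subset[of K "V \<union> ?B"] V'(1)
      by (metis open_Un open_ball)
    \<comment> \<open>\<open>V \<union> ?B\<close> may fail to be convex. The glued section is
      therefore restricted to a thin tube around the segment, which is convex as the Minkowski sum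
      of a segment and a ball.\<close>
    define V2 where "V2 = (\<Union>x\<in>K. ball x e)"
    define G2 where "G2 = (\<lambda>z. if z \<in> V then G z else g z)"
    have ball_sum: "ball x e = (\<Union>b\<in>ball 0 e. {x + b})" for x :: 'b
    proof -
      have "z \<in> (\<Union>b\<in>ball 0 e. {x + b})" if "z \<in> ball x e" for z
        using that by (intro UN_I[of "z - x"]) (auto simp: dist_norm norm_minus_commute)
      then show ?thesis by (auto simp: dist_norm)
    qed
    have "V2 = (\<Union>x\<in>K. \<Union>b\<in>ball 0 e. {x + b})"
      unfolding V2_def by (intro SUP_cong refl ball_sum)
    then have "convex V2"
      using convex_sums[of K "ball 0 e"] by (simp add: K_def)
    have "h \<tau> \<in> V2" "c \<in> V2" using e(1) unfolding V2_def K_def by (meson UN_I centre_in_ball ends_in_segment)+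
    have "continuous_on (V \<union> ?B) G2"
    proof -
      have "continuous_on V G2" using V' by (subst continuous_on_cong[of V V G2 G]) (auto simp: G2_def)
      moreover have "continuous_on ?B G2" using g eqG
        by (subst continuous_on_cong[of ?B ?B G2 g]) (auto simp: G2_def)
      ultimately show ?thesis using V' by (intro continuous_on_open_Un) auto
    qed
    moreover have V2: "V2 \<subseteq> V \<union> ?B" using e(2) by (simp add: V2_def)
    ultimately have "continuous_on V2 G2" by (rule continuous_on_subset)
    moreover have "F (G2 z) = z" if "z \<in> V2" for z
    proof (cases "z \<in> V")
      case False
      then have "z \<in> ?B" using that V2 by blast
      then show ?thesis using g(2) False by (simp add: G2_def)
    qed (simp add: G2_def V'(5))
    moreover have "open V2" by (auto simp: V2_def)
    ultimately have "good V2 G2"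
      using \<open>convex V2\<close> \<open>c \<in> V2\<close> V'(3,6) unfolding good_def by (simp add: G2_def)
    then have "h \<tau> \<in> \<Omega>" using \<open>h \<tau> \<in> V2\<close> unfolding \<Omega>_def by blast
    then show False using \<tau>B by (simp add: B_def)
  qed
  then have "\<Omega> = UNIV" by auto
  then show ?thesis using cont_s F_s sc by (auto simp: c_def)
qed

text \<open>The range is open and closed: by \<open>half\<close>, a local section whose image meets
  the range coincides with \<open>s\<close> on its whole ball, so its image lies either inside the
  range or outside it.\<close>

lemma global_section_surj:
  assumes conn: "connected (UNIV :: 'm set)"
    and s: "continuous_on UNIV s" "\<And>y. F (s y) = y"
  shows "range s = UNIV"
proof -
  have half: "g z = s z"
    if asm: "local_section F q g d" "y \<in> ball (F q) d" "g y \<in> range s" and z: "z \<in> ball (F q) d"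
    for q g d y z
  proof -
    obtain y' where y: "y \<in> ball (F q) d" "g y = s y'" using asm(2,3) by blast
    then have "y = y'" using asm(1) s(2) by (metis local_section_def)
    show "g z = s z"
    proof (rule lifts_agree[of "ball (F q) d" g s y])
      show "continuous_on (ball (F q) d) s" using s(1) continuous_on_subset by blast
    qed (use asm(1) y z s \<open>y = y'\<close> in \<open>auto simp: local_section_def\<close>)
  qed
  have sub1: "\<exists>T. open T \<and> q \<in> T \<and> T \<subseteq> range s" if "q \<in> range s" for q
  proof -
    obtain g d where g: "local_section F q g d" using ex_local_section by blast
    then have q: "F q \<in> ball (F q) d" "g (F q) = q" by (auto simp: local_section_def)
    then have "g z = s z" if "z \<in> ball (F q) d" for z
      using half[OF g, of "F q" z] that \<open>q \<in> range s\<close> by simp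
    then have "g ` ball (F q) d \<subseteq> range s" by auto
    moreover have "q \<in> g ` ball (F q) d" using q by (metis imageI)
    moreover have "open (g ` ball (F q) d)" using g by (simp add: local_section_def)
    ultimately show ?thesis by blast
  qed
  have sub2: "\<exists>T. open T \<and> q \<in> T \<and> T \<subseteq> - range s" if "q \<in> - range s" for q
  proof -
    obtain g d where g: "local_section F q g d" using ex_local_section by blast
    then have q: "F q \<in> ball (F q) d" "g (F q) = q" by (auto simp: local_section_def)
    have "g z \<notin> range s" if "z \<in> ball (F q) d" for z
      using half[OF g that _ q(1)] q(2) \<open>q \<in> - range s\<close> by auto
    then have "g ` ball (F q) d \<subseteq> - range s" by (simp add: image_subset_iff)
    moreover have "q \<in> g ` ball (F q) d" using q by (metis imageI)
    moreover have "open (g ` ball (F q) d)" using g by (simp add: local_section_def)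
    ultimately show ?thesis by blast
  qed
  have "open (range s)" by (rule Topological_Spaces.openI) (rule sub1)
  moreover have "open (- range s)" by (rule Topological_Spaces.openI) (rule sub2)
  ultimately have "range s \<inter> UNIV = {} \<or> - range s \<inter> UNIV = {}"
    by (intro connectedD[OF conn]) simp_all
  then show ?thesis by blast
qed

end

subsection \<open>Functions of two variables with semidefinite Hessian\<close>

text \<open>Schwarz's theorem when the gradient is merely differentiable at the point: the second
  difference \<open>\<Delta>\<close> over a small parallelogram is symmetric in \<open>a\<close> and
  \<open>b\<close> and approximates both mixed derivatives, up to a small multiple of
  \<open>t * t\<close>.\<close>

lemma symmetric_second_derivative:
  fixes u :: "'a::real_inner \<Rightarrow> real"
  assumes u: "\<And>y. (u has_derivative (\<lambda>v. G y \<bullet> v)) (at y)"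
    and G: "(G has_derivative D) (at y)"
  shows "D a \<bullet> b = D b \<bullet> a"
proof (rule ccontr)
  assume ne: "D a \<bullet> b \<noteq> D b \<bullet> a"
  define e where "e = \<bar>D a \<bullet> b - D b \<bullet> a\<bar>"
  have "e > 0" using ne by (simp add: e_def)
  define K where "K = norm a + norm b + 1"
  have K: "K \<ge> 1" by (simp add: K_def)
  \<comment> \<open>With this choice the two approximation errors, each at most
    \<open>t * t * (2 * \<eta> * K * K)\<close>, add up to at most half of
    \<open>t * t * e\<close>.\<close>
  define \<eta> where "\<eta> = e / (8 * K * K)"
  have "\<eta> > 0" using \<open>e > 0\<close> K by (simp add: \<eta>_def)
  interpret D: bounded_linear D using G by (rule has_derivative_bounded_linear)
  obtain d where "d > 0" and
      d: "\<And>z. norm (z - y) < d \<Longrightarrow> norm (G z - G y - D (z - y)) \<le> \<eta> * norm (z - y)"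
    using G \<open>\<eta> > 0\<close> unfolding has_derivative_at_alt by blast
  define t where "t = d / (2 * K)"
  have "t > 0" using \<open>d > 0\<close> K by (simp add: t_def)
  have "t * K < d" using \<open>d > 0\<close> K by (simp add: t_def)
  define \<Delta> where "\<Delta> = u (y + t *\<^sub>R a + t *\<^sub>R b) - u (y + t *\<^sub>R a) - u (y + t *\<^sub>R b) + u y"
  have key: "\<bar>u (y + t *\<^sub>R p + t *\<^sub>R q) - u (y + t *\<^sub>R p) - u (y + t *\<^sub>R q) + u y - t * t * (D q \<bullet> p)\<bar>
      \<le> t * t * (2 * \<eta> * K * K)" if pq: "norm p + norm q + 1 = K" for p q
  proof -
    \<comment> \<open>The mean value theorem turns the second difference into a difference of
      gradients at two points within \<open>t * K < d\<close> of \<open>y\<close>. Linearizing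
      \<open>G\<close> at \<open>y\<close> there leaves the main term
      \<open>t *\<^sub>R D q\<close>.\<close>
    define h where "h = (\<lambda>s. u (y + s *\<^sub>R p + t *\<^sub>R q) - u (y + s *\<^sub>R p))"
    have "DERIV h s :> (G (y + s *\<^sub>R p + t *\<^sub>R q) - G (y + s *\<^sub>R p)) \<bullet> p" for s
    proof -
      have "((\<lambda>s. y + s *\<^sub>R p + t *\<^sub>R q) has_derivative (\<lambda>s. s *\<^sub>R p)) (at s)"
        by (auto intro!: derivative_eq_intros)
      from has_derivative_compose[OF this u]
      have 1: "((\<lambda>s. u (y + s *\<^sub>R p + t *\<^sub>R q)) has_derivative (\<lambda>s'. G (y + s *\<^sub>R p + t *\<^sub>R q) \<bullet> (s' *\<^sub>R p))) (at s)" .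
      have "((\<lambda>s. y + s *\<^sub>R p) has_derivative (\<lambda>s. s *\<^sub>R p)) (at s)"
        by (auto intro!: derivative_eq_intros)
      from has_derivative_compose[OF this u]
      have 2: "((\<lambda>s. u (y + s *\<^sub>R p)) has_derivative (\<lambda>s'. G (y + s *\<^sub>R p) \<bullet> (s' *\<^sub>R p))) (at s)" .
      show ?thesis unfolding h_def has_field_derivative_def
        by (rule has_derivative_eq_rhs[OF has_derivative_diff[OF 1 2]])
          (auto simp: inner_diff_left algebra_simps)
    qed
    then obtain \<xi> where \<xi>: "0 < \<xi>" "\<xi> < t"
        "h t - h 0 = t * ((G (y + \<xi> *\<^sub>R p + t *\<^sub>R q) - G (y + \<xi> *\<^sub>R p)) \<bullet> p)"
      using MVT2[of 0 t h "\<lambda>s. (G (y + s *\<^sub>R p + t *\<^sub>R q) - G (y + s *\<^sub>R p)) \<bullet> p"] \<open>t > 0\<close> by auto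
    define z1 where "z1 = \<xi> *\<^sub>R p + t *\<^sub>R q"
    define z2 where "z2 = \<xi> *\<^sub>R p"
    have n2: "norm z2 \<le> t * norm p" using \<xi> by (simp add: z2_def mult_right_mono)
    have n1: "norm z1 \<le> t * norm p + t * norm q" unfolding z1_def
      using \<xi> \<open>t > 0\<close> by (intro norm_triangle_le add_mono) (auto simp: mult_right_mono)
    have tK: "t * norm p + t * norm q + t = t * K" by (simp add: pq[symmetric] algebra_simps)
    have tq: "0 \<le> t * norm q" using \<open>t > 0\<close> by simp
    have b1: "norm z1 \<le> t * K" and b2: "norm z2 \<le> t * K"
      using n1 n2 tK tq \<open>t > 0\<close> by linarith+
    have "norm (G (y + z1) - G y - D z1) \<le> \<eta> * norm z1"
      using d[of "y + z1"] b1 \<open>t * K < d\<close> by simp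
    also have "\<dots> \<le> \<eta> * (t * K)" using b1 \<open>\<eta> > 0\<close> by simp
    finally have g1: "norm (G (y + z1) - G y - D z1) \<le> \<eta> * (t * K)" .
    have "norm (G (y + z2) - G y - D z2) \<le> \<eta> * norm z2"
      using d[of "y + z2"] b2 \<open>t * K < d\<close> by simp
    also have "\<dots> \<le> \<eta> * (t * K)" using b2 \<open>\<eta> > 0\<close> by simp
    finally have g2: "norm (G (y + z2) - G y - D z2) \<le> \<eta> * (t * K)" .
    define r where "r = (G (y + z1) - G y - D z1) - (G (y + z2) - G y - D z2)"
    have "norm r \<le> 2 * \<eta> * (t * K)"
      unfolding r_def using norm_triangle_ineq4[of "G (y + z1) - G y - D z1" "G (y + z2) - G y - D z2"] g1 g2 by linarith
    moreover have "norm p \<le> K" using pq norm_ge_zero[of q] by linarith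
    ultimately have r: "\<bar>r \<bullet> p\<bar> \<le> (2 * \<eta> * (t * K)) * K"
      using Cauchy_Schwarz_ineq2[of r p] mult_mono[of "norm r" "2 * \<eta> * (t * K)" "norm p" K] \<open>\<eta> > 0\<close> \<open>t > 0\<close> K
      by simp
    have "D z1 - D z2 = t *\<^sub>R D q" by (simp add: z1_def z2_def D.add D.scaleR)
    then have "G (y + z1) - G (y + z2) = t *\<^sub>R D q + r" by (simp add: r_def algebra_simps)
    then have "h t - h 0 = t * (t * (D q \<bullet> p) + r \<bullet> p)"
      using \<xi>(3) by (simp add: z1_def z2_def inner_add_left add.assoc)
    then have "h t - h 0 - t * t * (D q \<bullet> p) = t * (r \<bullet> p)" by (simp add: algebra_simps)
    then have "\<bar>h t - h 0 - t * t * (D q \<bullet> p)\<bar> = t * \<bar>r \<bullet> p\<bar>" using \<open>t > 0\<close> by (simp add: abs_mult)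
    also have "\<dots> \<le> t * ((2 * \<eta> * (t * K)) * K)" using r \<open>t > 0\<close> by (intro mult_left_mono) auto
    finally show ?thesis by (simp add: h_def algebra_simps)
  qed
  have k1: "\<bar>\<Delta> - t * t * (D b \<bullet> a)\<bar> \<le> t * t * (2 * \<eta> * K * K)"
    using key[of a b] by (simp add: \<Delta>_def K_def)
  have k2: "\<bar>\<Delta> - t * t * (D a \<bullet> b)\<bar> \<le> t * t * (2 * \<eta> * K * K)"
    using key[of b a] by (simp add: \<Delta>_def K_def algebra_simps)
  have "t * t * e = \<bar>t * t * (D a \<bullet> b) - t * t * (D b \<bullet> a)\<bar>"
    using \<open>t > 0\<close> by (simp add: e_def abs_mult flip: right_diff_distrib)
  also have "\<dots> \<le> 2 * (t * t * (2 * \<eta> * K * K))" using k1 k2 by linarith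
  also have "\<dots> = t * t * (e / 2)" using K by (simp add: \<eta>_def field_simps)
  finally show False using \<open>t > 0\<close> \<open>e > 0\<close> by simp
qed

text \<open>Along the segment from \<open>q\<close> to \<open>p\<close> the component of
  \<open>G\<close> in the direction \<open>p - q\<close> has a value of the quadratic form of
  \<open>D\<close> as its derivative.\<close>

lemma gradient_monotone:
  fixes G :: "'a::real_inner \<Rightarrow> 'a"
  assumes G: "\<And>y. (G has_derivative D y) (at y)" and psd: "\<And>y v. 0 \<le> D y v \<bullet> v"
  shows "0 \<le> (G p - G q) \<bullet> (p - q)"
proof -
  define h where "h = (\<lambda>t. G (q + t *\<^sub>R (p - q)) \<bullet> (p - q))"
  have "DERIV h t :> D (q + t *\<^sub>R (p - q)) (p - q) \<bullet> (p - q)" for t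
  proof -
    interpret D: bounded_linear "D (q + t *\<^sub>R (p - q))" using G by (rule has_derivative_bounded_linear)
    have "((\<lambda>s. q + s *\<^sub>R (p - q)) has_derivative (\<lambda>s. s *\<^sub>R (p - q))) (at t)"
      by (auto intro!: derivative_eq_intros)
    from has_derivative_compose[OF this G]
    have "((\<lambda>s. G (q + s *\<^sub>R (p - q))) has_derivative (\<lambda>s. D (q + t *\<^sub>R (p - q)) (s *\<^sub>R (p - q)))) (at t)" .
    from has_derivative_inner_left[OF this, of "p - q"] show ?thesis
      unfolding h_def has_field_derivative_def
      by (rule has_derivative_eq_rhs) (auto simp: D.scaleR mult.commute)
  qed
  then have "\<exists>y. DERIV h t :> y \<and> 0 \<le> y" for t
    using psd by blast
  then have "h 0 \<le> h 1" by (rule DERIV_nonneg_imp_nondecreasing[OF zero_le_one])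
  then show ?thesis by (simp add: h_def inner_diff_left)
qed

lemma inner_real2: "(x::real^2) \<bullet> y = x$1 * y$1 + x$2 * y$2"
  by (simp add: inner_vec_def sum_2)

lemmas has_derivative_vec_nth = bounded_linear.has_derivative[OF bounded_linear_vec_nth]

lemma linear_real2:
  fixes D :: "real^2 \<Rightarrow> 'b::real_vector"
  assumes "linear D"
  shows "D v = v $ 1 *\<^sub>R D (axis 1 1) + v $ 2 *\<^sub>R D (axis 2 1)"
proof -
  have "v = v $ 1 *\<^sub>R axis 1 1 + v $ 2 *\<^sub>R axis 2 1"
    by (simp add: vec_eq_iff forall_2 axis_def)
  from arg_cong[OF this, of D] show ?thesis
    by (simp only: linear_add[OF assms] linear_scale[OF assms])
qed

text \<open>For a graph with gradient \<open>(a, b)\<close> and Hessian entries \<open>p\<close>,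
  \<open>q\<close>, \<open>r\<close>, the expression in \<open>tr\<close> is the trace of the
  Hessian against the adjugate of the metric. It equals \<open>p + r\<close> plus the quadratic form
  at \<open>(b, -a)\<close>, so its sign decides which semidefinite sign the Hessian has.\<close>

lemma psd_2x2:
  fixes a b p q r :: real
  assumes det: "q * q \<le> p * r" and tr: "0 \<le> (1 + b*b) * p - 2*a*b*q + (1 + a*a) * r"
  shows "0 \<le> p" "0 \<le> r" "0 \<le> p*x*x + 2*q*x*y + r*y*y"
    "(1 + b*b) * p - 2*a*b*q + (1 + a*a) * r \<le> (1 + a*a + b*b) * (p + r)"
    "q * q + r * r \<le> ((1 + b*b) * p - 2*a*b*q + (1 + a*a) * r)\<^sup>2"
proof -
  have quad: "0 \<le> p*x*x + 2*q*x*y + r*y*y" if "0 \<le> p" "0 \<le> r" "q * q \<le> p * r" for p q r x y :: real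
  proof (cases "p = 0")
    case True
    then have "q = 0" using that by (auto simp: mult_le_0_iff)
    then show ?thesis using True that by (simp add: mult.assoc)
  next
    case False
    have "p * (p*x*x + 2*q*x*y + r*y*y) = (p*x + q*y)*(p*x + q*y) + (p*r - q*q)*(y*y)"
      by (simp add: algebra_simps)
    also have "\<dots> \<ge> 0" using that by (intro add_nonneg_nonneg mult_nonneg_nonneg zero_le_square) auto
    finally show ?thesis using False that by (simp add: zero_le_mult_iff)
  qed
  have pr: "0 \<le> p * r" using det by (meson order_trans zero_le_square)
  have "\<not> (p < 0 \<or> r < 0)"
  proof
    assume neg: "p < 0 \<or> r < 0"
    then have le: "p \<le> 0" "r \<le> 0" using pr by (auto simp: zero_le_mult_iff)
    \<comment> \<open>The negated form at \<open>(b, -a)\<close> shows that the trace expression is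
      at most \<open>p + r\<close>, which is negative here.\<close>
    have "0 \<le> (-p)*b*b + 2*(-q)*b*(-a) + (-r)*(-a)*(-a)"
      by (rule quad) (use le det in auto)
    then have "(1 + b*b) * p - 2*a*b*q + (1 + a*a) * r \<le> p + r" by (simp add: algebra_simps)
    then show False using tr le neg by linarith
  qed
  then show pos: "0 \<le> p" "0 \<le> r" by auto
  show "0 \<le> p*x*x + 2*q*x*y + r*y*y" by (rule quad[OF pos det])
  \<comment> \<open>The form at \<open>(a, b)\<close> is exactly the difference of the two sides of
    the upper bound.\<close>
  have "0 \<le> p*a*a + 2*q*a*b + r*b*b" by (rule quad[OF pos det])
  then show "(1 + b*b) * p - 2*a*b*q + (1 + a*a) * r \<le> (1 + a*a + b*b) * (p + r)"
    by (simp add: algebra_simps)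
  have "0 \<le> p*b*b + 2*q*b*(-a) + r*(-a)*(-a)" by (rule quad[OF pos det])
  then have ge: "p + r \<le> (1 + b*b) * p - 2*a*b*q + (1 + a*a) * r" by (simp add: algebra_simps)
  have "q * q + r * r \<le> (p + r) * (p + r)"
  proof -
    have "(p + r) * (p + r) = p * p + 2 * (p * r) + r * r" by (simp add: algebra_simps)
    then show ?thesis using det pr zero_le_square[of p] by linarith
  qed
  also have "\<dots> \<le> ((1 + b*b) * p - 2*a*b*q + (1 + a*a) * r)\<^sup>2"
    unfolding power2_eq_square using ge pos by (intro mult_mono) auto
  finally show "q * q + r * r \<le> ((1 + b*b) * p - 2*a*b*q + (1 + a*a) * r)\<^sup>2" .
qed

section \<open>Restriction to lines, a Gronwall estimate and a maximum principle\<close>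

lemma DERIV_along_line:
  fixes f :: "'a::real_normed_vector \<Rightarrow> real"
  assumes "(f has_derivative D) (at (q + t *\<^sub>R v))"
  shows "DERIV (\<lambda>t. f (q + t *\<^sub>R v)) t :> D v"
proof -
  interpret D: bounded_linear D using assms by (rule has_derivative_bounded_linear)
  have "((\<lambda>s. q + s *\<^sub>R v) has_derivative (\<lambda>s. s *\<^sub>R v)) (at t)"
    by (auto intro!: derivative_eq_intros)
  from has_derivative_compose[OF this assms] show ?thesis
    unfolding has_field_derivative_def
    by (rule has_derivative_eq_rhs) (auto simp: D.scaleR mult.commute)
qed

lemma vanishing_propagates:
  fixes h :: "real \<Rightarrow> real"
  assumes h: "\<And>t. DERIV h t :> h' t" and le: "\<And>t. 0 \<le> t \<Longrightarrow> t \<le> 1 \<Longrightarrow> \<bar>h' t\<bar> \<le> C * \<bar>h t\<bar>"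
    and 0: "h 0 = 0"
  shows "h 1 = 0"
proof -
  \<comment> \<open>Gronwall: the weight makes \<open>h\<^sup>2\<close> nonincreasing.\<close>
  define k where "k = (\<lambda>t. h t * h t * exp (- 2 * C * t))"
  have k: "DERIV k t :> (2 * h t * h' t - 2 * C * (h t * h t)) * exp (- 2 * C * t)" for t
    unfolding k_def by (auto intro!: derivative_eq_intros h simp: algebra_simps)
  have "(2 * h t * h' t - 2 * C * (h t * h t)) * exp (- 2 * C * t) \<le> 0" if "0 \<le> t" "t \<le> 1" for t
  proof -
    have "h t * h' t \<le> \<bar>h t\<bar> * \<bar>h' t\<bar>" by (metis abs_ge_self abs_mult)
    also have "\<dots> \<le> \<bar>h t\<bar> * (C * \<bar>h t\<bar>)" by (intro mult_left_mono le that) auto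
    also have "\<dots> = C * (h t * h t)" by (simp add: algebra_simps)
    finally show ?thesis by (simp add: mult_le_0_iff)
  qed
  then have "\<exists>y. DERIV k t :> y \<and> y \<le> 0" if "0 \<le> t" "t \<le> 1" for t
    using k that by blast
  then have "k 1 \<le> k 0" by (rule DERIV_nonpos_imp_nonincreasing[OF zero_le_one])
  then have "h 1 * h 1 \<le> 0" by (simp add: k_def 0 mult_le_0_iff)
  then show ?thesis by (auto simp: mult_le_0_iff)
qed

text \<open>If \<open>l\<close> were positive, \<open>h'\<close>, which vanishes at the maximum,
  would be positive just to the right of it, and \<open>h\<close> would increase there.\<close>

lemma second_derivative_test_max:
  fixes h :: "real \<Rightarrow> real"
  assumes d: "d > 0" and h: "\<And>t. \<bar>t\<bar> < d \<Longrightarrow> DERIV h t :> h' t" and h': "DERIV h' 0 :> l"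
    and max: "\<And>t. \<bar>t\<bar> < d \<Longrightarrow> h t \<le> h 0"
  shows "l \<le> 0"
proof (rule ccontr)
  assume "\<not> l \<le> 0"
  have "h' 0 = 0"
    by (rule DERIV_local_max[OF h d]) (use d max in auto)
  obtain e where e: "e > 0" "\<And>t. 0 < t \<Longrightarrow> t < e \<Longrightarrow> h' 0 < h' t"
    using DERIV_pos_inc_right[OF h'] \<open>\<not> l \<le> 0\<close> by auto
  define t where "t = min d e / 2"
  have t: "0 < t" "t < d" "t < e" using d e(1) by (auto simp: t_def)
  obtain z where z: "0 < z" "z < t" "h t - h 0 = (t - 0) * h' z"
    using MVT2[of 0 t h h'] h t by auto
  have "h' z > 0" using e(2)[of z] z t \<open>h' 0 = 0\<close> by auto
  then have "h t > h 0" using z t by (simp add: zero_less_mult_iff) (smt (verit) mult_pos_pos)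
  then show False using max[of t] t by auto
qed

text \<open>Maximum principle for \<open>u\<close> minus a paraboloid with Laplacian
  \<open>c / 2\<close>. On the boundary of the disc the paraboloid exceeds the possible growth
  \<open>M * \<rho>\<close> of \<open>u\<close>, so the difference \<open>w\<close> has an interior
  maximum, where the Laplacian of \<open>u\<close> is at most \<open>c / 2\<close>.\<close>

lemma no_large_laplacian:
  fixes u :: "real^2 \<Rightarrow> real" and G :: "real^2 \<Rightarrow> real^2"
  assumes u: "\<And>y. (u has_derivative (\<lambda>v. G y \<bullet> v)) (at y)"
    and G: "\<And>y. (G has_derivative D y) (at y)"
    and M: "\<And>y. norm (G y) \<le> M"
    and "0 < c" "0 < \<rho>" "16 * M < c * \<rho>"
  shows "\<exists>y\<in>cball q \<rho>. D y (axis 1 1) $ 1 + D y (axis 2 1) $ 2 < c"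
proof -
  define w where "w = (\<lambda>y. u y - c / 8 * ((y - q) \<bullet> (y - q)))"
  have w: "(w has_derivative (\<lambda>v. (G y - (c / 4) *\<^sub>R (y - q)) \<bullet> v)) (at y)" for y
    unfolding w_def
    by (rule derivative_eq_intros u refl)+
      (auto simp: inner_diff_left inner_diff_right inner_commute algebra_simps)
  have "continuous_on (cball q \<rho>) w"
    using w by (meson continuous_at_imp_continuous_on has_derivative_continuous)
  then obtain m where m: "m \<in> cball q \<rho>" "\<And>y. y \<in> cball q \<rho> \<Longrightarrow> w y \<le> w m"
    using continuous_attains_sup[of "cball q \<rho>" w] \<open>0 < \<rho>\<close> by auto
  have "norm (m - q) < \<rho>"
  proof (rule ccontr)
    assume "\<not> norm (m - q) < \<rho>"
    then have n: "norm (m - q) = \<rho>" using m(1) by (simp add: dist_norm norm_minus_commute)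
    have "norm (u m - u q) \<le> M * norm (m - q)"
    proof (rule differentiable_bound[of UNIV])
      show "onorm (\<lambda>v. G x \<bullet> v) \<le> M" for x
      proof (rule onorm_bound)
        show "0 \<le> M" using M[of x] norm_ge_zero order_trans by blast
        show "norm (G x \<bullet> v) \<le> M * norm v" for v
          using Cauchy_Schwarz_ineq2[of "G x" v] mult_right_mono[OF M[of x] norm_ge_zero[of v]]
          by (simp add: order_trans)
      qed
    qed (use u in auto)
    then have "u m \<le> u q + M * \<rho>" using n by (simp add: abs_le_iff)
    moreover have "u q \<le> u m - c / 8 * (\<rho> * \<rho>)"
      using m(2)[of q] \<open>0 < \<rho>\<close> n by (simp add: w_def dot_square_norm power2_eq_square)
    ultimately have "c * \<rho> * \<rho> \<le> 8 * M * \<rho>" by (simp add: algebra_simps)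
    then have "c * \<rho> \<le> 8 * M" using \<open>0 < \<rho>\<close> by (simp add: mult_le_cancel_right)
    moreover have "0 \<le> M" using M[of 0] norm_ge_zero order_trans by blast
    ultimately show False using \<open>16 * M < c * \<rho>\<close> by linarith
  qed
  define d where "d = \<rho> - norm (m - q)"
  have "d > 0" using \<open>norm (m - q) < \<rho>\<close> by (simp add: d_def)
  have "D m (axis i 1) $ i \<le> c / 4" for i :: 2
  proof -
    let ?e = "axis i (1::real) :: real^2"
    have "D m ?e $ i - c / 4 \<le> 0"
    proof (rule second_derivative_test_max[OF \<open>d > 0\<close>, where h = "\<lambda>t. w (m + t *\<^sub>R ?e)"
          and h' = "\<lambda>t. G (m + t *\<^sub>R ?e) $ i - c / 4 * (m + t *\<^sub>R ?e - q) $ i"])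
      show "DERIV (\<lambda>t. w (m + t *\<^sub>R ?e)) t :> G (m + t *\<^sub>R ?e) $ i - c / 4 * (m + t *\<^sub>R ?e - q) $ i" for t
        using DERIV_along_line[OF w, where q = m and t = t and v = ?e] by (simp add: inner_axis)
      have "((\<lambda>y. G y $ i - c / 4 * (y - q) $ i) has_derivative (\<lambda>v. D m v $ i - c / 4 * v $ i)) (at m)"
        by (rule derivative_eq_intros has_derivative_vec_nth G refl)+ simp
      then have "((\<lambda>y. G y $ i - c / 4 * (y - q) $ i) has_derivative (\<lambda>v. D m v $ i - c / 4 * v $ i))
          (at (m + 0 *\<^sub>R ?e))" by simp
      from DERIV_along_line[OF this]
      show "DERIV (\<lambda>t. G (m + t *\<^sub>R ?e) $ i - c / 4 * (m + t *\<^sub>R ?e - q) $ i) 0 :> D m ?e $ i - c / 4"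
        by simp
      show "w (m + t *\<^sub>R ?e) \<le> w (m + 0 *\<^sub>R ?e)" if "\<bar>t\<bar> < d" for t
      proof -
        have "norm (m + t *\<^sub>R ?e - q) \<le> norm (m - q) + \<bar>t\<bar>"
          using norm_triangle_ineq[of "m - q" "t *\<^sub>R ?e"] by (simp add: algebra_simps)
        then show ?thesis using m(2) that by (simp add: d_def dist_norm norm_minus_commute)
      qed
    qed
    then show ?thesis by simp
  qed
  from this[of 1] this[of 2] show ?thesis using m(1) \<open>0 < c\<close> by (intro bexI[of _ m]) auto
qed

text \<open>Comparing the gradient at \<open>y\<close> with that at the origin by monotonicity: far
  away in the direction \<open>\<theta>\<close> but at bounded horizontal distance, the vertical
  slope is at least half of its value \<open>p0\<close> at the origin. Then \<open>tr\<close> bounds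
  the Laplacian below on a disc too large for the bounded gradient.\<close>

lemma no_entire_convex_solution:
  fixes u :: "real^2 \<Rightarrow> real" and G :: "real^2 \<Rightarrow> real^2"
  assumes u: "\<And>y. (u has_derivative (\<lambda>v. G y \<bullet> v)) (at y)"
    and G: "\<And>y. (G has_derivative D y) (at y)"
    and M: "\<And>y. norm (G y) \<le> M"
    and psd: "\<And>y v. 0 \<le> D y v \<bullet> v"
    and \<theta>: "\<theta> = 1 \<or> \<theta> = (-1::real)"
    and pos: "\<And>y. 0 < \<theta> * (G y $ 2)"
    and "0 < c"
    and tr: "\<And>y. z0 \<le> \<theta> * (y $ 2) \<Longrightarrow>
       c * (\<theta> * (G y $ 2)) \<le> D y (axis 1 1) $ 1 + D y (axis 2 1) $ 2"
  shows False
proof -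
  define p0 where "p0 = \<theta> * (G 0 $ 2)"
  have "p0 > 0" using pos by (simp add: p0_def)
  have M0: "0 \<le> M" using M[of 0] norm_ge_zero order_trans by blast
  define c' where "c' = c * p0 / 2"
  have c': "c' > 0" using \<open>c > 0\<close> \<open>p0 > 0\<close> by (simp add: c'_def)
  define \<rho> where "\<rho> = (16 * M + 1) / c'"
  have \<rho>: "\<rho> > 0" "16 * M < c' * \<rho>" using c' M0 by (auto simp: \<rho>_def)
  \<comment> \<open>The radius \<open>\<rho>\<close> is fixed first. This height ensures
    \<open>\<theta> * (y $ 2) \<ge> z0\<close> on the whole disc, and also
    \<open>\<theta> * (y $ 2) \<ge> 4 * M * \<rho> / p0\<close>, so that the horizontal contribution
    \<open>2 * M * \<rho>\<close> costs at most half of \<open>p0\<close>.\<close>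
  define Z where "Z = \<rho> + \<bar>z0\<bar> + 4 * M * \<rho> / p0 + 1"
  define q where "q = \<theta> *\<^sub>R (axis 2 Z :: real^2)"
  have near: "c' \<le> D y (axis 1 1) $ 1 + D y (axis 2 1) $ 2" if "y \<in> cball q \<rho>" for y
  proof -
    have nq: "norm (y - q) \<le> \<rho>" using that by (simp add: dist_norm norm_minus_commute)
    have x: "\<bar>y $ 1\<bar> \<le> \<rho>"
      using order_trans[OF component_le_norm_cart[of "y - q" 1] nq] by (simp add: q_def axis_def)
    have "\<bar>y $ 2 - \<theta> * Z\<bar> \<le> \<rho>"
      using order_trans[OF component_le_norm_cart[of "y - q" 2] nq] by (simp add: q_def axis_def)
    then have z: "Z - \<rho> \<le> \<theta> * (y $ 2)" using \<theta> by (auto simp: abs_le_iff)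
    have t0: "0 \<le> 4 * M * \<rho> / p0" using M0 \<rho>(1) \<open>p0 > 0\<close> by simp
    then have z': "z0 \<le> \<theta> * (y $ 2)" "4 * M * \<rho> / p0 \<le> \<theta> * (y $ 2)" "0 < \<theta> * (y $ 2)"
      using z by (auto simp: Z_def)
    have a: "\<bar>G y $ 1 - G 0 $ 1\<bar> \<le> 2 * M"
      using order_trans[OF component_le_norm_cart[of "G y" 1] M[of y]]
        order_trans[OF component_le_norm_cart[of "G 0" 1] M[of 0]] by linarith
    have "(G y $ 1 - G 0 $ 1) * y $ 1 \<le> \<bar>G y $ 1 - G 0 $ 1\<bar> * \<bar>y $ 1\<bar>"
      by (metis abs_ge_self abs_mult)
    also have "\<dots> \<le> 2 * M * \<rho>" using a x M0 by (intro mult_mono) auto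
    finally have a': "(G y $ 1 - G 0 $ 1) * y $ 1 \<le> 2 * M * \<rho>" .
    have "0 \<le> (G y - G 0) \<bullet> (y - 0)" by (rule gradient_monotone[OF G psd])
    then have "0 \<le> (G y $ 1 - G 0 $ 1) * y $ 1 + (G y $ 2 - G 0 $ 2) * y $ 2"
      by (simp add: inner_real2)
    also have "(G y $ 2 - G 0 $ 2) * y $ 2 = (\<theta> * (G y $ 2) - p0) * (\<theta> * (y $ 2))"
      using \<theta> by (auto simp: p0_def)
    finally have m: "0 \<le> 2 * M * \<rho> + (\<theta> * (G y $ 2) - p0) * (\<theta> * (y $ 2))" using a' by linarith
    have "p0 / 2 \<le> \<theta> * (G y $ 2)"
    proof (rule ccontr)
      assume n: "\<not> p0 / 2 \<le> \<theta> * (G y $ 2)"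
      then have "(\<theta> * (G y $ 2) - p0) * (\<theta> * (y $ 2)) < (- p0 / 2) * (\<theta> * (y $ 2))"
        using z'(3) by (intro mult_strict_right_mono) auto
      moreover have "(p0 / 2) * (4 * M * \<rho> / p0) \<le> (p0 / 2) * (\<theta> * (y $ 2))"
        using z'(2) \<open>p0 > 0\<close> by (intro mult_left_mono) auto
      ultimately show False using m \<open>p0 > 0\<close> by simp
    qed
    then have "c * (p0 / 2) \<le> c * (\<theta> * (G y $ 2))" using \<open>c > 0\<close> by (intro mult_left_mono) auto
    then show ?thesis using tr[OF z'(1)] by (simp add: c'_def)
  qed
  obtain y where "y \<in> cball q \<rho>" "D y (axis 1 1) $ 1 + D y (axis 2 1) $ 2 < c'"
    using no_large_laplacian[OF u G M c' \<rho>] by blast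
  then show False using near[of y] by linarith
qed

text \<open>For the graph of \<open>u\<close>, \<open>f\<close> is the derivative of the weight,
  \<open>det\<close> expresses nonnegative Gauss curvature and \<open>eq\<close> is the minimality
  equation without denominators. The cases are: \<open>b\<close> has a zero; \<open>b\<close> has
  none and \<open>f\<close> is nonzero somewhere, which is contradictory; \<open>b\<close> has none
  and \<open>f\<close> is identically zero, which makes the Hessian vanish at once.\<close>

theorem bounded_gradient_rigidity:
  fixes u :: "real^2 \<Rightarrow> real" and G :: "real^2 \<Rightarrow> real^2" and D :: "real^2 \<Rightarrow> real^2 \<Rightarrow> real^2" and f :: "real \<Rightarrow> real"
  defines "a \<equiv> \<lambda>y. G y $ 1" and "b \<equiv> \<lambda>y. G y $ 2"
    and "p \<equiv> \<lambda>y. D y (axis 1 1) $ 1" and "q \<equiv> \<lambda>y. D y (axis 1 1) $ 2" and "r \<equiv> \<lambda>y. D y (axis 2 1) $ 2"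
  assumes u: "\<And>y. (u has_derivative (\<lambda>v. G y \<bullet> v)) (at y)"
    and G: "\<And>y. (G has_derivative D y) (at y)"
    and M: "\<And>y. norm (G y) \<le> M"
    and det: "\<And>y. q y * q y \<le> p y * r y"
    and eq: "\<And>y. (1 + b y * b y) * p y - 2 * a y * b y * q y + (1 + a y * a y) * r y
        = - f (y $ 2) * b y * (1 + a y * a y + b y * b y)"
    and anti: "antimono f" and sgn: "(\<forall>z. 0 \<le> f z) \<or> (\<forall>z. f z \<le> 0)"
  shows "G y = G 0"
proof -
  \<comment> \<open>\<open>W\<close> is the determinant of the graph metric, and \<open>T\<close> is
    \<open>W\<close> times the trace of the Hessian with respect to the inverse metric.\<close>
  define T where "T = (\<lambda>y. (1 + b y * b y) * p y - 2 * a y * b y * q y + (1 + a y * a y) * r y)"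
  define W where "W = (\<lambda>y. 1 + a y * a y + b y * b y)"
  have W1: "1 \<le> W y" for y by (simp add: W_def)
  have T: "T y = - f (y $ 2) * b y * W y" for y using eq by (simp add: T_def W_def)
  have lin: "linear (D y)" for y using G has_derivative_linear by blast
  have sym: "D y (axis 2 1) $ 1 = q y" for y
    using symmetric_second_derivative[OF u G, of y "axis 1 1" "axis 2 1"]
    by (simp add: q_def inner_axis)
  have Dv: "D y v = vector [p y * v $ 1 + q y * v $ 2, q y * v $ 1 + r y * v $ 2]" for y v
    using linear_real2[OF lin, of y v] sym by (simp add: vec_eq_iff forall_2 p_def q_def r_def)
  have Dvv: "D y v \<bullet> v = p y * v $ 1 * v $ 1 + 2 * q y * v $ 1 * v $ 2 + r y * v $ 2 * v $ 2" for y v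
    by (simp add: Dv inner_real2 algebra_simps)
  have psdT: "0 \<le> D y v \<bullet> v" "T y \<le> W y * (p y + r y)" if "0 \<le> T y" for y v
    using psd_2x2[of "q y" "p y" "r y" "b y" "a y"] det[of y] that unfolding Dvv T_def W_def by auto
  have nsdT: "0 \<le> - D y v \<bullet> v" "- T y \<le> W y * (- p y - r y)" if "T y \<le> 0" for y v
    using psd_2x2(3)[where q = "- q y" and p = "- p y" and r = "- r y" and b = "b y" and a = "a y"
        and x = "v $ 1" and y = "v $ 2"]
      psd_2x2(4)[of "- q y" "- p y" "- r y" "b y" "a y"] det[of y] that
    unfolding inner_minus_left Dvv T_def W_def by (auto simp: algebra_simps)
  \<comment> \<open>Since \<open>(q, r)\<close> is the gradient of \<open>b\<close>, this bounds
    that gradient by \<open>\<bar>T\<bar>\<close>, which is locally at most a constant times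
    \<open>\<bar>b\<bar>\<close>. That is the differential inequality for the Gronwall step.\<close>
  have le: "q y * q y + r y * r y \<le> (T y)\<^sup>2" for y
  proof (cases "0 \<le> T y")
    case True
    then show ?thesis using psd_2x2(5)[of "q y" "p y" "r y" "b y" "a y"] det[of y] by (simp add: T_def)
  next
    case False
    then have "0 \<le> - T y" by simp
    then show ?thesis using psd_2x2(5)[of "- q y" "- p y" "- r y" "b y" "a y"] det[of y]
      by (simp add: T_def algebra_simps power2_eq_square)
  qed
  have WM: "W y \<le> 1 + M * M" for y
  proof -
    have "W y = 1 + norm (G y) * norm (G y)"
      by (simp add: W_def a_def b_def norm_eq_sqrt_inner inner_real2)
    also have "\<dots> \<le> 1 + M * M" using M[of y] by (intro add_mono mult_mono) (auto intro: order_trans[OF norm_ge_zero])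
    finally show ?thesis .
  qed
  show ?thesis
  proof (cases "\<exists>y1. b y1 = 0")
    case True
    then obtain y1 where y1: "b y1 = 0" by blast
    have b0: "b y = 0" for y
    proof -
      define v where "v = y - y1"
      \<comment> \<open>As \<open>f\<close> is monotone, its two end values bound
        \<open>\<bar>f\<bar>\<close> at all heights along the segment.\<close>
      define F where "F = max \<bar>f (y1 $ 2)\<bar> \<bar>f (y $ 2)\<bar>"
      have "(\<lambda>t. b (y1 + t *\<^sub>R v)) 1 = 0"
      proof (rule vanishing_propagates)
        show "DERIV (\<lambda>t. b (y1 + t *\<^sub>R v)) t :> D (y1 + t *\<^sub>R v) v $ 2" for t
          unfolding b_def by (intro DERIV_along_line has_derivative_vec_nth G)
        show "b (y1 + 0 *\<^sub>R v) = 0" using y1 by simp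
        show "\<bar>D (y1 + t *\<^sub>R v) v $ 2\<bar> \<le> (norm v * (F * (1 + M * M))) * \<bar>b (y1 + t *\<^sub>R v)\<bar>"
          if t: "0 \<le> t" "t \<le> 1" for t
        proof -
          define x where "x = y1 + t *\<^sub>R v"
          have "x $ 2 \<in> closed_segment (y1 $ 2) (y $ 2)"
            unfolding in_segment using t by (intro exI[of _ t]) (auto simp: x_def v_def algebra_simps)
          then have "\<bar>f (x $ 2)\<bar> \<le> F"
            using antimonoD[OF anti] unfolding closed_segment_eq_real_ivl F_def
            by (smt (verit) atLeastAtMost_iff)
          then have "\<bar>f (x $ 2)\<bar> * W x \<le> F * (1 + M * M)"
            using WM W1[of x] by (intro mult_mono) auto
          then have fT: "\<bar>T x\<bar> \<le> F * (1 + M * M) * \<bar>b x\<bar>"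
            using W1[of x] mult_right_mono[of "\<bar>f (x $ 2)\<bar> * W x" "F * (1 + M * M)" "\<bar>b x\<bar>"]
            by (simp add: T abs_mult algebra_simps)
          define g where "g = (vector [q x, r x] :: real^2)"
          have "(norm g)\<^sup>2 \<le> \<bar>T x\<bar>\<^sup>2"
            using le[of x] by (simp add: g_def power2_norm_eq_inner inner_real2)
          then have "norm g \<le> \<bar>T x\<bar>" by (rule power2_le_imp_le) simp
          have "D x v $ 2 = g \<bullet> v" by (simp add: Dv g_def inner_real2)
          then have "\<bar>D x v $ 2\<bar> \<le> norm g * norm v" using Cauchy_Schwarz_ineq2 by metis
          also have "\<dots> \<le> (F * (1 + M * M) * \<bar>b x\<bar>) * norm v"
            using \<open>norm g \<le> \<bar>T x\<bar>\<close> fT by (intro mult_right_mono) auto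
          finally show ?thesis by (simp add: x_def algebra_simps)
        qed
      qed
      then show ?thesis by (simp add: v_def)
    qed
    have "D y = (\<lambda>v. 0)" for y
    proof -
      have "T y = 0" by (simp add: T b0)
      have "q y * q y + r y * r y \<le> 0" using le[of y] \<open>T y = 0\<close> by simp
      then have qr: "q y = 0" "r y = 0" using sum_squares_le_zero_iff by blast+
      then have "p y = 0" using \<open>T y = 0\<close> b0 by (simp add: T_def)
      show ?thesis by (rule ext) (simp add: Dv qr \<open>p y = 0\<close> vec_eq_iff forall_2)
    qed
    then have "(G has_derivative (\<lambda>v. 0)) (at y within UNIV)" for y using G by metis
    then show ?thesis
      using has_derivative_zero_unique[of UNIV G] by (metis UNIV_I convex_UNIV)
  next
    case False
    have cb: "continuous_on UNIV b"
      unfolding b_def by (intro continuous_at_imp_continuous_on ballI)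
        (rule has_derivative_continuous[OF has_derivative_vec_nth[OF G]])
    have "(\<forall>y. 0 < b y) \<or> (\<forall>y. b y < 0)"
    proof (rule ccontr)
      assume "\<not> ?thesis"
      then obtain y1 y2 where "b y1 \<le> 0" "0 \<le> b y2" by (auto simp: not_less)
      moreover have "connected (b ` UNIV)" by (intro connected_continuous_image cb convex_connected convex_UNIV)
      ultimately have "0 \<in> b ` UNIV" by (meson connectedD_interval rangeI)
      then show False using False by (metis imageE)
    qed
    then obtain \<kappa> :: real where \<kappa>: "\<kappa> = 1 \<or> \<kappa> = -1" "\<And>y. 0 < \<kappa> * b y"
      by (metis mult_minus1 mult_1 neg_0_less_iff_less)
    show ?thesis
    proof (cases "\<exists>z. f z \<noteq> 0")
      case True
      then obtain z0 where z0: "f z0 \<noteq> 0" by blast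
      define \<sigma> where "\<sigma> = sgn (f z0)"
      have \<sigma>: "\<sigma> = 1 \<or> \<sigma> = -1" using z0 by (auto simp: \<sigma>_def sgn_if)
      have \<sigma>f: "0 \<le> \<sigma> * f z" for z
        using sgn
      proof
        assume "\<forall>z. 0 \<le> f z"
        moreover then have "f z0 > 0" using z0 by (simp add: less_le)
        ultimately show ?thesis by (simp add: \<sigma>_def)
      next
        assume "\<forall>z. f z \<le> 0"
        moreover then have "f z0 < 0" using z0 by (simp add: less_le)
        ultimately show ?thesis by (simp add: \<sigma>_def)
      qed
      \<comment> \<open>As \<open>f\<close> is decreasing, \<open>\<theta>\<close> is the vertical
        direction in which \<open>\<bar>f\<bar> = \<sigma> * f\<close> grows. The sign
        \<open>\<tau>\<close> is chosen to make \<open>\<tau> * T\<close> nonnegative, so that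
        \<open>\<tau> * u\<close> is convex.\<close>
      define \<theta> where "\<theta> = - \<sigma>"
      define \<tau> where "\<tau> = - \<sigma> * \<kappa>"
      have \<tau>: "\<tau> = 1 \<or> \<tau> = -1" using \<sigma> \<kappa>(1) by (auto simp: \<tau>_def)
      have \<tau>T: "\<tau> * T y = (\<sigma> * f (y $ 2)) * (\<kappa> * b y) * W y" for y
        by (simp add: \<tau>_def T)
      then have \<tau>T0: "0 \<le> \<tau> * T y" for y
        using \<sigma>f[of "y $ 2"] \<kappa>(2)[of y] W1[of y] by (simp add: less_imp_le)
      have False
      proof (rule no_entire_convex_solution)
        show "((\<lambda>y. \<tau> * u y) has_derivative (\<lambda>v. (\<tau> *\<^sub>R G y) \<bullet> v)) (at y)" for y
          using has_derivative_mult_right[OF u, of \<tau>] by simp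
        show "((\<lambda>y. \<tau> *\<^sub>R G y) has_derivative (\<lambda>v. \<tau> *\<^sub>R D y v)) (at y)" for y
          by (intro has_derivative_scaleR_right G)
        show "norm (\<tau> *\<^sub>R G y) \<le> M" for y using M \<tau> by auto
        show "0 \<le> (\<tau> *\<^sub>R D y v) \<bullet> v" for y v
          using \<tau> \<tau>T0[of y] psdT(1)[of y v] nsdT(1)[of y v] by auto
        show "\<theta> = 1 \<or> \<theta> = -1" using \<sigma> by (auto simp: \<theta>_def)
        have "\<theta> * \<tau> = \<kappa>" using \<sigma> by (auto simp: \<theta>_def \<tau>_def)
        then have \<theta>G: "\<theta> * ((\<tau> *\<^sub>R G y) $ 2) = \<kappa> * b y" for y
          by (simp add: b_def flip: mult.assoc)
        show "0 < \<theta> * ((\<tau> *\<^sub>R G y) $ 2)" for y using \<kappa>(2) \<theta>G by simp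
        \<comment> \<open>The constant is \<open>\<bar>f z0\<bar>\<close>, a lower bound of
          \<open>\<bar>f\<bar>\<close> at all heights beyond \<open>z0\<close> in the direction
          \<open>\<theta>\<close>.\<close>
        show "0 < \<sigma> * f z0" using \<sigma>f[of z0] z0 \<sigma> by auto
        show "\<sigma> * f z0 * (\<theta> * ((\<tau> *\<^sub>R G y) $ 2)) \<le>
            (\<tau> *\<^sub>R D y (axis 1 1)) $ 1 + (\<tau> *\<^sub>R D y (axis 2 1)) $ 2"
          if "\<theta> * z0 \<le> \<theta> * (y $ 2)" for y
        proof -
          have "\<sigma> * f z0 \<le> \<sigma> * f (y $ 2)"
            using \<sigma> that antimonoD[OF anti, of z0 "y $ 2"] antimonoD[OF anti, of "y $ 2" z0]
            by (auto simp: \<theta>_def)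
          then have "\<sigma> * f z0 * (\<kappa> * b y) * W y \<le> \<tau> * T y"
            unfolding \<tau>T using \<kappa>(2)[of y] W1[of y] by (intro mult_right_mono) auto
          also have "\<dots> \<le> W y * (\<tau> * (p y + r y))"
            using \<tau> \<tau>T0[of y] psdT(2)[of y] nsdT(2)[of y] by auto
          finally have "W y * (\<sigma> * f z0 * (\<kappa> * b y)) \<le> W y * (\<tau> * (p y + r y))"
            by (simp add: mult.commute)
          then have "\<sigma> * f z0 * (\<kappa> * b y) \<le> \<tau> * (p y + r y)"
            using W1[of y] by (simp add: mult_le_cancel_left)
          then show ?thesis unfolding \<theta>G by (simp add: p_def r_def distrib_left)
        qed
      qed
      then show ?thesis ..
    next
      case False
      have "D y = (\<lambda>v. 0)" for y
      proof -
        have "T y = 0" using False by (simp add: T)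
        then have "q y * q y + r y * r y \<le> 0" using le[of y] by simp
        then have qr: "q y = 0" "r y = 0" using sum_squares_le_zero_iff by blast+
        then have "(1 + b y * b y) * p y = 0" using \<open>T y = 0\<close> by (simp add: T_def)
        moreover have "1 + b y * b y > 0" by (simp add: add_pos_nonneg)
        ultimately have "p y = 0" by simp
        show ?thesis by (rule ext) (simp add: Dv qr \<open>p y = 0\<close> vec_eq_iff forall_2)
      qed
      then have "(G has_derivative (\<lambda>v. 0)) (at y within UNIV)" for y using G by metis
      then show ?thesis
        using has_derivative_zero_unique[of UNIV G] by (metis UNIV_I convex_UNIV)
    qed
  qed
qed

subsection \<open>Projection along a horizontal direction\<close>

text \<open>
  For a horizontal unit vector \<open>y\<close>, the components of \<open>tproj y v\<close> refer to the orthonormal vectors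
  \<open>(y $ 2, - y $ 1, 0)\<close> and \<open>e3\<close>, which span the orthogonal complement of \<open>y\<close>; \<open>tlift y n v\<close> is the
  vector orthogonal to \<open>n\<close> over \<open>v\<close>.
\<close>

definition tproj :: "real^3 \<Rightarrow> real^3 \<Rightarrow> real^2" where
  "tproj y v = vector [v $ 1 * y $ 2 - v $ 2 * y $ 1, v $ 3]"

definition tlift :: "real^3 \<Rightarrow> real^3 \<Rightarrow> real^2 \<Rightarrow> real^3" where
  "tlift y n v = vector [v $ 1 * y $ 2, - v $ 1 * y $ 1, v $ 2] - ((v \<bullet> tproj y n) / (n \<bullet> y)) *\<^sub>R y"

lemma inner_real3: "(x::real^3) \<bullet> y = x$1 * y$1 + x$2 * y$2 + x$3 * y$3"
  by (simp add: inner_vec_def sum_3)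

lemma bounded_linear_tproj [simp]: "bounded_linear (tproj y)"
  unfolding tproj_def
  by (rule linear_conv_bounded_linear[THEN iffD1], rule linearI)
    (simp_all add: vec_eq_iff forall_2 algebra_simps)

lemma bounded_linear_tlift [simp]: "bounded_linear (tlift y n)"
  unfolding tlift_def
  by (rule linear_conv_bounded_linear[THEN iffD1], rule linearI)
    (simp_all add: vec_eq_iff forall_3 inner_add_left algebra_simps add_divide_distrib)

locale horizontal =
  fixes y :: "real^3"
  assumes norm_y: "norm y = 1" and y_e3: "y \<bullet> e3 = 0"
begin

abbreviation "Q \<equiv> tproj y"
abbreviation "T \<equiv> tlift y"

lemma y3: "y $ 3 = 0" using y_e3 by (simp add: inner_axis)

lemma y12: "y $ 1 * y $ 1 + y $ 2 * y $ 2 = 1"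
  using norm_y by (simp add: norm_eq_1 inner_real3 y3)

text \<open>The inner product in the orthonormal frame \<open>(y $ 2, - y $ 1, 0)\<close>,
  \<open>e3\<close>, \<open>y\<close>.\<close>

lemma inner_decomp: "a \<bullet> b = Q a \<bullet> Q b + (a \<bullet> y) * (b \<bullet> y)"
proof -
  have "Q a \<bullet> Q b + (a \<bullet> y) * (b \<bullet> y) =
     (a$1 * b$1 + a$2 * b$2) * (y $ 1 * y $ 1 + y $ 2 * y $ 2) + a$3 * b$3"
    by (simp add: tproj_def inner_real2 inner_real3 y3 algebra_simps)
  then show ?thesis by (simp add: y12 inner_real3)
qed

lemma decomp_eqI: "Q a = Q b \<Longrightarrow> a \<bullet> y = b \<bullet> y \<Longrightarrow> a = b"
  using inner_decomp[of "a - b" "a - b"]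
  by (simp add: linear_diff[OF bounded_linear.linear[OF bounded_linear_tproj]] inner_diff_left[of a b y])

lemma Q_T: "Q (T n v) = v"
proof -
  have "v $ 1 * y $ 2 * y $ 2 + v $ 1 * y $ 1 * y $ 1 = v $ 1"
    using y12 by (simp add: algebra_simps flip: distrib_left)
  then show ?thesis
    by (simp add: tproj_def tlift_def vec_eq_iff forall_2 y3 algebra_simps)
qed

lemma T_y: "T n v \<bullet> y = - (v \<bullet> Q n) / (n \<bullet> y)"
proof -
  have yy: "y \<bullet> y = 1" using norm_y by (simp add: norm_eq_1)
  have "vector [v $ 1 * y $ 2, - v $ 1 * y $ 1, v $ 2] \<bullet> y = 0"
    by (simp add: inner_real3 y3)
  then show ?thesis by (simp add: tlift_def inner_diff_left yy)
qed

text \<open>Orthogonality to \<open>n\<close> is a linear equation that determines the component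
  along \<open>y\<close> from the projection, because \<open>n \<bullet> y\<close> is
  nonzero.\<close>

lemma T_unique: "n \<bullet> y \<noteq> 0 \<Longrightarrow> t \<bullet> n = 0 \<Longrightarrow> t = T n (Q t)"
  using inner_decomp[of t n] by (intro decomp_eqI) (simp_all add: Q_T T_y field_simps)

lemma norm_Q_le: "norm (Q v) \<le> norm v"
proof -
  have "(norm (Q v))\<^sup>2 \<le> (norm v)\<^sup>2"
    using inner_decomp[of v v] by (simp add: power2_norm_eq_inner)
  then show ?thesis by (rule power2_le_imp_le) simp
qed

text \<open>By Cauchy-Schwarz and
  \<open>\<bar>Q n\<bar>\<^sup>2 = 1 - (n \<bullet> y)\<^sup>2\<close>, lifting to the tangent plane
  stretches by at most \<open>1 / \<bar>n \<bullet> y\<bar>\<close>. This bounds the lengths of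
  lifted segments.\<close>

lemma norm_T_le:
  assumes n: "norm n = 1" and e: "n \<bullet> y \<le> - 2 * e" "e > 0"
  shows "norm (T n v) \<le> norm v / (2 * e)"
proof -
  have ny: "n \<bullet> y \<noteq> 0" using e by auto
  have nn: "Q n \<bullet> Q n + (n \<bullet> y) * (n \<bullet> y) = 1"
    using inner_decomp[of n n] n by (simp add: norm_eq_1)
  have "(v \<bullet> Q n)\<^sup>2 \<le> (v \<bullet> v) * (Q n \<bullet> Q n)" by (rule Cauchy_Schwarz_ineq)
  also have "\<dots> = (v \<bullet> v) * (1 - (n \<bullet> y)\<^sup>2)" using nn by (simp add: power2_eq_square eq_diff_eq)
  finally have "(v \<bullet> v) * (n \<bullet> y)\<^sup>2 + (v \<bullet> Q n)\<^sup>2 \<le> v \<bullet> v" by (simp add: algebra_simps)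
  moreover have "(norm (T n v))\<^sup>2 = v \<bullet> v + (v \<bullet> Q n)\<^sup>2 / (n \<bullet> y)\<^sup>2"
    using inner_decomp[of "T n v" "T n v"]
    by (simp add: Q_T T_y power2_norm_eq_inner) (simp add: power2_eq_square)
  ultimately have "(norm (T n v))\<^sup>2 \<le> (norm v)\<^sup>2 / (n \<bullet> y)\<^sup>2"
    using ny by (simp add: field_simps power2_norm_eq_inner)
  also have "\<dots> = (norm v / \<bar>n \<bullet> y\<bar>)\<^sup>2" by (simp add: power_divide)
  finally have "norm (T n v) \<le> norm v / \<bar>n \<bullet> y\<bar>" by (rule power2_le_imp_le) simp
  also have "\<dots> \<le> norm v / (2 * e)" using e by (intro frac_le) auto
  finally show ?thesis .
qed

text \<open>The vector is the gradient of a graph over the plane with unit normal \<open>n\<close>,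
  so this is the source of the gradient bound.\<close>

lemma norm_slope_le:
  assumes n: "norm n = 1" and e: "n \<bullet> y \<le> - 2 * e" "e > 0"
  shows "norm (- (1 / (n \<bullet> y)) *\<^sub>R Q n) \<le> 1 / (2 * e)"
proof -
  have "norm (- (1 / (n \<bullet> y)) *\<^sub>R Q n) = norm (Q n) / \<bar>n \<bullet> y\<bar>" by simp
  also have "\<dots> \<le> 1 / (2 * e)" using norm_Q_le[of n] n e by (intro frac_le) auto
  finally show ?thesis .
qed

lemma continuous_on_T:
  assumes "continuous_on S n" "\<And>x. x \<in> S \<Longrightarrow> n x \<bullet> y \<noteq> 0"
  shows "continuous_on S (\<lambda>x. T (n x) v)"
  unfolding tlift_def
  by (intro continuous_intros assms bounded_linear.continuous_on[OF bounded_linear_tproj]) (use assms in auto)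

text \<open>The vector paired with \<open>a\<close> on the right is the derivative of
  \<open>- (1 / (n \<bullet> y)) *\<^sub>R Q n\<close> when \<open>n\<close> moves with velocity
  \<open>m\<close>. The identity thus converts the second fundamental form into the Hessian of the
  graph function.\<close>

lemma second_fundamental_identity:
  assumes ny: "n \<bullet> y \<noteq> 0"
  shows "- (T n a \<bullet> m) = (n \<bullet> y) * (a \<bullet> (- (1 / (n \<bullet> y)) *\<^sub>R Q m + ((m \<bullet> y) / (n \<bullet> y)\<^sup>2) *\<^sub>R Q n))"
proof -
  have "T n a \<bullet> m = a \<bullet> Q m - (a \<bullet> Q n) / (n \<bullet> y) * (m \<bullet> y)"
    by (subst inner_decomp) (simp add: Q_T T_y)
  then show ?thesis using ny by (simp add: inner_add_right inner_diff_right power2_eq_square) (simp add: field_simps)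
qed

end

section \<open>Smooth maps and the inverse function theorem\<close>

lemma smooth_onD:
  assumes "smooth_on U f" "x \<in> U"
  shows "(f has_derivative frechet_derivative f (at x)) (at x)"
    "(\<lambda>x. frechet_derivative f (at x) v) differentiable (at x)"
proof -
  have "Ck_on 2 U f" using assms by (simp add: smooth_on_def)
  then show "(f has_derivative frechet_derivative f (at x)) (at x)"
    "(\<lambda>x. frechet_derivative f (at x) v) differentiable (at x)"
    using assms(2) by (auto simp: eval_nat_numeral frechet_derivative_works)
qed

text \<open>The inverse function theorem, with the derivative given vector by vector. In finite
  dimension pointwise continuity of \<open>f' x v\<close> amounts to continuity in the operator
  norm, and an injective endomorphism is invertible.\<close>

lemma invertible_derivative_local_inverse:
  fixes f :: "'a::euclidean_space \<Rightarrow> 'a"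
  assumes U: "open U" "x0 \<in> U"
    and f: "\<And>x. x \<in> U \<Longrightarrow> (f has_derivative f' x) (at x)"
    and cont: "\<And>v. continuous_on U (\<lambda>x. f' x v)"
    and inj: "\<And>x. x \<in> U \<Longrightarrow> inj (f' x)"
  obtains g d where "0 < d" "continuous_on (ball (f x0) d) g" "g (f x0) = x0"
    "\<And>y. y \<in> ball (f x0) d \<Longrightarrow> g y \<in> U \<and> f (g y) = y" "open (g ` ball (f x0) d)"
    "\<And>y. y \<in> ball (f x0) d \<Longrightarrow> (g has_derivative inv (f' (g y))) (at y)"
proof -
  define F where "F = (\<lambda>x. Blinfun (f' x))"
  have F: "blinfun_apply (F x) = f' x" if "x \<in> U" for x
    unfolding F_def using f[OF that] by (intro bounded_linear_Blinfun_apply has_derivative_bounded_linear)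
  have "continuous_on U F"
    unfolding continuous_on_def
  proof
    fix x assume x: "x \<in> U"
    show "(F \<longlongrightarrow> F x) (at x within U)"
    proof (rule tendsto_componentwise1)
      fix j :: 'a
      have "((\<lambda>z. f' z j) \<longlongrightarrow> f' x j) (at x within U)" using cont x by (simp add: continuous_on_def)
      moreover have "eventually (\<lambda>z. f' z j = F z j) (at x within U)"
        using F by (auto simp: eventually_at_filter)
      ultimately show "((\<lambda>z. F z j) \<longlongrightarrow> F x j) (at x within U)"
        unfolding F[OF x] by (rule Lim_transform_eventually)
    qed
  qed
  have lin0: "linear (f' x0)" using f[OF U(2)] by (rule has_derivative_linear)
  obtain h where h: "linear h" "\<And>v. h (f' x0 v) = v" "\<And>v. f' x0 (h v) = v"
    using linear_injective_isomorphism[OF lin0 inj[OF U(2)]] by auto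
  then have "blinfun_apply (Blinfun h) = h"
    by (intro bounded_linear_Blinfun_apply) (simp add: linear_conv_bounded_linear)
  then have hF: "Blinfun h o\<^sub>L F x0 = id_blinfun"
    using h F[OF U(2)] by (intro blinfun_eqI) simp
  obtain U' V g g' where g: "open U'" "U' \<subseteq> U" "x0 \<in> U'" "open V" "f x0 \<in> V" "homeomorphism U' V f g"
    "\<And>y. y \<in> V \<Longrightarrow> (g has_derivative (g' y)) (at y)"
    "\<And>y. y \<in> V \<Longrightarrow> g' y = inv (blinfun_apply (F (g y)))"
    using inverse_function_theorem[OF U(1) _ \<open>continuous_on U F\<close> U(2) hF] f F by metis
  obtain d where d: "0 < d" "ball (f x0) d \<subseteq> V" using g(4,5) openE by blast
  have gU: "g y \<in> U'" "f (g y) = y" if "y \<in> V" for y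
    using g(6) that by (auto simp: homeomorphism_def)
  show thesis
  proof
    show "continuous_on (ball (f x0) d) g"
      using homeomorphism_cont2[OF g(6)] d(2) by (rule continuous_on_subset)
    show "g (f x0) = x0" using g(3,6) by (simp add: homeomorphism_def)
    show "g y \<in> U \<and> f (g y) = y" if "y \<in> ball (f x0) d" for y
      using gU[of y] that d(2) g(2) by blast
    have "g ` ball (f x0) d = U' \<inter> f -` ball (f x0) d"
    proof (intro equalityI subsetI)
      fix z assume "z \<in> g ` ball (f x0) d"
      then obtain y where "y \<in> ball (f x0) d" "z = g y" by blast
      then show "z \<in> U' \<inter> f -` ball (f x0) d" using gU[of y] d(2) by auto
    next
      fix z assume z: "z \<in> U' \<inter> f -` ball (f x0) d"
      then have "z = g (f z)" using g(6) by (simp add: homeomorphism_def)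
      then show "z \<in> g ` ball (f x0) d" using z by blast
    qed
    then show "open (g ` ball (f x0) d)"
      using continuous_open_preimage[OF homeomorphism_cont1[OF g(6)] g(1) open_ball] by simp
    show "(g has_derivative inv (f' (g y))) (at y)" if "y \<in> ball (f x0) d" for y
    proof -
      have "y \<in> V" using that d by blast
      then show ?thesis using g(7)[of y] g(8)[of y] gU[of y] g(2) F by auto
    qed
  qed (fact d)
qed

subsection \<open>The induced distance\<close>

definition path_length :: "('m::topological_space \<Rightarrow> real^3) \<Rightarrow> (real \<Rightarrow> 'm) \<Rightarrow> 'm \<Rightarrow> 'm \<Rightarrow> real \<Rightarrow> bool" where
  "path_length X \<gamma> p q L \<longleftrightarrow> path \<gamma> \<and> pathstart \<gamma> = p \<and> pathfinish \<gamma> = q \<and>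
     valid_path (X \<circ> \<gamma>) \<and>
     ((\<lambda>t. norm (vector_derivative (X \<circ> \<gamma>) (at t))) has_integral L) {0..1}"

lemma induced_dist_eq: "induced_dist X p q = Inf {L. \<exists>\<gamma>. path_length X \<gamma> p q L}"
  by (simp add: induced_dist_def path_length_def)

lemma path_length_nonneg: "path_length X \<gamma> p q L \<Longrightarrow> 0 \<le> L"
  unfolding path_length_def by (meson has_integral_nonneg norm_ge_zero)

lemma induced_dist_le: "path_length X \<gamma> p q L \<Longrightarrow> induced_dist X p q \<le> L"
  unfolding induced_dist_eq
  by (rule cInf_lower) (auto intro!: bdd_belowI[of _ 0] dest: path_length_nonneg)

text \<open>The given curve, whatever its length, guarantees that the infimum is taken over a
  nonempty set.\<close>

lemma induced_dist_less_path:
  assumes "path_length X \<gamma> p q L" "induced_dist X p q < d"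
  shows "\<exists>\<gamma> L. path_length X \<gamma> p q L \<and> L < d"
  using assms cInf_lessD[of "{L. \<exists>\<gamma>. path_length X \<gamma> p q L}" d]
  unfolding induced_dist_eq by auto

lemma valid_path_derivative:
  assumes "valid_path f"
  obtains S where "finite S"
    "\<And>t. t \<in> {0..1} - S \<Longrightarrow> (f has_vector_derivative vector_derivative f (at t)) (at t)"
  using assms unfolding valid_path_def piecewise_C1_differentiable_on_def C1_differentiable_on_eq
  by (metis vector_derivative_works)

text \<open>Each half is run at double speed over an interval of half the length, so its length is
  unchanged. The parameter \<open>1/2\<close> and the rescaled exceptional parameters form a finite
  set, which the integrals ignore.\<close>

lemma path_length_join:
  assumes 1: "path_length X \<gamma> p q L" and 2: "path_length X \<delta> q r K"
  shows "path_length X (\<gamma> +++ \<delta>) p r (L + K)"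
proof -
  define f where "f = X \<circ> \<gamma>"
  define g where "g = X \<circ> \<delta>"
  have c: "X \<circ> (\<gamma> +++ \<delta>) = f +++ g" by (simp add: f_def g_def path_compose_join)
  have f: "valid_path f" "((\<lambda>t. norm (vector_derivative f (at t))) has_integral L) {0..1}"
    and g: "valid_path g" "((\<lambda>t. norm (vector_derivative g (at t))) has_integral K) {0..1}"
    and ends: "pathfinish \<gamma> = pathstart \<delta>"
    using 1 2 by (auto simp: path_length_def f_def g_def)
  have fg: "pathfinish f = pathstart g" using ends by (simp add: f_def g_def pathfinish_def pathstart_def)
  obtain S where S: "finite S" "\<And>t. t \<in> {0..1} - S \<Longrightarrow> (f has_vector_derivative vector_derivative f (at t)) (at t)"
    using valid_path_derivative[OF f(1)] by blast
  obtain S' where S': "finite S'" "\<And>t. t \<in> {0..1} - S' \<Longrightarrow> (g has_vector_derivative vector_derivative g (at t)) (at t)"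
    using valid_path_derivative[OF g(1)] by blast
  have d1: "vector_derivative (f +++ g) (at t) = 2 *\<^sub>R vector_derivative f (at (2 * t))"
    if t: "t \<in> {0..1/2} - insert (1/2) ((\<lambda>x. x / 2) ` S)" for t
  proof (rule vector_derivative_at)
    have "2 * t \<notin> S"
    proof
      assume "2 * t \<in> S"
      then have "t \<in> (\<lambda>x. x / 2) ` S" by (rule image_eqI[rotated]) simp
      then show False using t by blast
    qed
    then have "(f has_vector_derivative vector_derivative f (at (2 * t))) (at (2 * t))"
      using t by (intro S(2)) auto
    moreover have "((\<lambda>x. 2 * x) has_vector_derivative 2) (at t)"
      by (auto intro!: derivative_eq_intros)
    ultimately have "(f \<circ> (\<lambda>x. 2 * x) has_vector_derivative 2 *\<^sub>R vector_derivative f (at (2 * t))) (at t)"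
      by (intro vector_diff_chain_at)
    then show "(f +++ g has_vector_derivative 2 *\<^sub>R vector_derivative f (at (2 * t))) (at t)"
      by (rule has_vector_derivative_transform_within_open[of _ _ _ "{..<1/2}"])
        (use t in \<open>auto simp: joinpaths_def\<close>)
  qed
  have d2: "vector_derivative (f +++ g) (at t) = 2 *\<^sub>R vector_derivative g (at (2 * t - 1))"
    if t: "t \<in> {1/2..1} - insert (1/2) ((\<lambda>x. (x + 1) / 2) ` S')" for t
  proof (rule vector_derivative_at)
    have "2 * t - 1 \<notin> S'"
    proof
      assume "2 * t - 1 \<in> S'"
      then have "t \<in> (\<lambda>x. (x + 1) / 2) ` S'" by (rule image_eqI[rotated]) simp
      then show False using t by blast
    qed
    then have "(g has_vector_derivative vector_derivative g (at (2 * t - 1))) (at (2 * t - 1))"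
      using t by (intro S'(2)) auto
    moreover have "((\<lambda>x. 2 * x - 1) has_vector_derivative 2) (at t)"
      by (auto intro!: derivative_eq_intros)
    ultimately have "(g \<circ> (\<lambda>x. 2 * x - 1) has_vector_derivative 2 *\<^sub>R vector_derivative g (at (2 * t - 1))) (at t)"
      by (intro vector_diff_chain_at)
    then show "(f +++ g has_vector_derivative 2 *\<^sub>R vector_derivative g (at (2 * t - 1))) (at t)"
      by (rule has_vector_derivative_transform_within_open[of _ _ _ "{1/2<..}"])
        (use t in \<open>auto simp: joinpaths_def\<close>)
  qed
  have "((\<lambda>t. 2 * norm (vector_derivative f (at (2 * t)))) has_integral L) {0..1/2}"
    using has_integral_affinity01[OF f(2), of 2 0, THEN has_integral_mult_right[where c = 2]] by simp
  then have i1: "((\<lambda>t. norm (vector_derivative (f +++ g) (at t))) has_integral L) {0..1/2}"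
    by (rule has_integral_spike_finite[of "insert (1/2) ((\<lambda>x. x / 2) ` S)", rotated 2])
      (use S(1) d1 in auto)
  have "x \<in> (\<lambda>x. x / 2 + 1 / 2) ` {0..1}" if "x \<in> {1/2..1}" for x :: real
    by (rule image_eqI[of _ _ "2 * x - 1"]) (use that in \<open>auto simp: field_simps\<close>)
  then have im: "(\<lambda>x. x / 2 + 1 / 2) ` {0..1::real} = {1/2..1}" by auto
  have "((\<lambda>t. 2 * norm (vector_derivative g (at (2 * t - 1)))) has_integral K) {1/2..1}"
    using has_integral_affinity01[OF g(2), of 2 "-1", THEN has_integral_mult_right[where c = 2]]
    by (simp add: im)
  then have i2: "((\<lambda>t. norm (vector_derivative (f +++ g) (at t))) has_integral K) {1/2..1}"
    by (rule has_integral_spike_finite[of "insert (1/2) ((\<lambda>x. (x + 1) / 2) ` S')", rotated 2])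
      (use S'(1) d2 in auto)
  have "((\<lambda>t. norm (vector_derivative (f +++ g) (at t))) has_integral L + K) {0..1}"
    by (rule has_integral_combine[OF _ _ i1 i2]) auto
  moreover have "valid_path (f +++ g)" using f g fg by (intro valid_path_join)
  moreover have "path (\<gamma> +++ \<delta>)" using 1 2 ends by (auto simp: path_length_def)
  ultimately show ?thesis using 1 2 by (simp add: path_length_def c)
qed

text \<open>The chord is the integral of the velocity over \<open>{t..1}\<close>. Having this for
  every \<open>t\<close> keeps the whole curve close to its end point, not only its start.\<close>

lemma path_length_ge_dist:
  assumes "path_length X \<gamma> p q L" and t: "t \<in> {0..1}"
  shows "dist (X (\<gamma> t)) (X q) \<le> L"
proof -
  define f where "f = X \<circ> \<gamma>"
  have f: "valid_path f" "((\<lambda>t. norm (vector_derivative f (at t))) has_integral L) {0..1}" "f 1 = X q"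
    using assms(1) by (auto simp: path_length_def f_def pathfinish_def)
  obtain S where S: "finite S" "\<And>t. t \<in> {0..1} - S \<Longrightarrow> (f has_vector_derivative vector_derivative f (at t)) (at t)"
    using valid_path_derivative[OF f(1)] by blast
  have "continuous_on {0..1} f" using valid_path_imp_path[OF f(1)] by (simp add: path_def)
  then have "continuous_on {t..1} f" using t by (auto elim: continuous_on_subset)
  then have I: "((\<lambda>t. vector_derivative f (at t)) has_integral (f 1 - f t)) {t..1}"
    using t S by (intro fundamental_theorem_of_calculus_interior_strong[OF S(1)]) auto
  have int: "(\<lambda>t. norm (vector_derivative f (at t))) integrable_on {t..1}"
    using integrable_on_subinterval[OF has_integral_integrable[OF f(2)]] t by auto
  have "norm (f 1 - f t) \<le> integral {t..1} (\<lambda>t. norm (vector_derivative f (at t)))"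
    using integral_norm_bound_integral[OF has_integral_integrable[OF I] int] integral_unique[OF I] by simp
  also have "\<dots> \<le> L"
    using integral_subset_le[OF _ int has_integral_integrable[OF f(2)]] t integral_unique[OF f(2)] by auto
  finally show ?thesis using f(3) by (simp add: f_def dist_norm norm_minus_commute)
qed

subsection \<open>Surfaces with Gauss map in a compact part of a hemisphere\<close>

locale steep_surface = horizontal y for y +
  fixes A :: "'m::{t2_space,second_countable_topology} atlas"
    and X N :: "'m \<Rightarrow> real^3" and \<epsilon> :: real
  assumes surface: "oriented_immersed_surface A X N"
    and complete: "complete_surface X"
    and \<epsilon>: "0 < \<epsilon>" and steep: "\<And>p. N p \<bullet> y \<le> - 2 * \<epsilon>"
begin

abbreviation "F \<equiv> \<lambda>p. Q (X p)"

lemma norm_N: "norm (N p) = 1"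
  using surface by (simp add: oriented_immersed_surface_def unit_normal_def)

lemma N_y: "N p \<bullet> y < 0" "N p \<bullet> y \<noteq> 0"
proof -
  show "N p \<bullet> y < 0" using steep[of p] \<epsilon> by linarith
  then show "N p \<bullet> y \<noteq> 0" by simp
qed

lemma chart:
  assumes "(U, \<psi>) \<in> A"
  shows "open U" "open (\<psi> ` U)" "homeomorphism U (\<psi> ` U) \<psi> (inv_into U \<psi>)"
    "smooth_on U (X \<circ> \<psi>)" "smooth_on U (N \<circ> \<psi>)"
    "\<And>u. u \<in> U \<Longrightarrow> inj (frechet_derivative (X \<circ> \<psi>) (at u))"
    "\<And>u v. u \<in> U \<Longrightarrow> frechet_derivative (X \<circ> \<psi>) (at u) v \<bullet> N (\<psi> u) = 0"
  using surface assms
  by (fastforce simp: oriented_immersed_surface_def smooth_surface_def immersion_def unit_normal_def smooth_map_def)+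

lemma ex_chart:
  obtains U \<psi> u where "(U, \<psi>) \<in> A" "u \<in> U" "\<psi> u = p"
proof -
  have "p \<in> (\<Union>(U,\<psi>)\<in>A. \<psi> ` U)"
    using surface by (simp add: oriented_immersed_surface_def smooth_surface_def)
  then show thesis using that by auto
qed

lemma smooth_map_continuous:
  assumes f: "\<And>U \<psi>. (U, \<psi>) \<in> A \<Longrightarrow> smooth_on U (f \<circ> \<psi>)"
  shows "continuous_on UNIV f"
proof -
  have "isCont f p" for p
  proof -
    obtain U \<psi> u where c: "(U, \<psi>) \<in> A" "u \<in> U" "\<psi> u = p" by (rule ex_chart)
    have "continuous_on U (f \<circ> \<psi>)"
      by (intro continuous_at_imp_continuous_on ballI)
        (rule has_derivative_continuous[OF smooth_onD(1)[OF f[OF c(1)]]])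
    then have "continuous_on (\<psi> ` U) (\<lambda>p. (f \<circ> \<psi>) (inv_into U \<psi> p))"
      by (rule continuous_on_compose2[OF _ homeomorphism_cont2[OF chart(3)[OF c(1)]]])
        (auto intro: inv_into_into)
    then have "continuous_on (\<psi> ` U) f"
      by (rule continuous_on_eq) (simp add: f_inv_into_f)
    then show ?thesis using c chart(2)[OF c(1)] by (auto simp: continuous_on_eq_continuous_at)
  qed
  then show ?thesis by (simp add: continuous_on_eq_continuous_at)
qed

lemma continuous_X: "continuous_on S X"
  using smooth_map_continuous chart(4) continuous_on_subset by blast

lemma continuous_N: "continuous_on S N"
  using smooth_map_continuous chart(5) continuous_on_subset by blast

text \<open>Tangent vectors are recovered from their projections by \<open>T\<close>, so injectivity
  of the derivative of the immersion passes to its projection.\<close>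

lemma chart_deriv:
  assumes c: "(U, \<psi>) \<in> A" and u: "u \<in> U"
  defines "P \<equiv> \<lambda>v. Q (frechet_derivative (X \<circ> \<psi>) (at u) v)"
  shows "(F \<circ> \<psi> has_derivative P) (at u)" "inj P"
    "frechet_derivative (X \<circ> \<psi>) (at u) = (\<lambda>v. T (N (\<psi> u)) (P v))"
proof -
  note d = smooth_onD(1)[OF chart(4)[OF c] u]
  show "(F \<circ> \<psi> has_derivative P) (at u)"
    using bounded_linear.has_derivative[OF bounded_linear_tproj d, of y] by (simp add: P_def o_def)
  show eq: "frechet_derivative (X \<circ> \<psi>) (at u) = (\<lambda>v. T (N (\<psi> u)) (P v))"
    unfolding P_def using T_unique[OF N_y(2) chart(7)[OF c u]] by auto
  show "inj P"
  proof (rule injI)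
    fix v w assume "P v = P w"
    then have "frechet_derivative (X \<circ> \<psi>) (at u) v = frechet_derivative (X \<circ> \<psi>) (at u) w"
      using fun_cong[OF eq] by metis
    then show "v = w" using chart(6)[OF c u] by (simp add: inj_eq)
  qed
qed

text \<open>In a chart, \<open>F\<close> has an invertible derivative \<open>P\<close>, and
  \<open>g\<close> is the chart after the local inverse \<open>k\<close>. The derivative of
  \<open>X \<circ> \<psi>\<close> is \<open>T\<close> after \<open>P\<close>, and \<open>P\<close>
  cancels against the derivative of \<open>k\<close>, so the derivative of
  \<open>X \<circ> g\<close> does not depend on the chart.\<close>

lemma ex_graph_section:
  obtains g d where "local_section F p g d"
    "\<And>z. z \<in> ball (F p) d \<Longrightarrow> (X \<circ> g has_derivative T (N (g z))) (at z)"
    "\<And>z. z \<in> ball (F p) d \<Longrightarrow> (N \<circ> g) differentiable (at z)"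
proof -
  obtain U \<psi> u where c: "(U, \<psi>) \<in> A" "u \<in> U" "\<psi> u = p" by (rule ex_chart)
  define P where "P = (\<lambda>u v. Q (frechet_derivative (X \<circ> \<psi>) (at u) v))"
  have dF: "(F \<circ> \<psi> has_derivative P u) (at u)" "inj (P u)"
    and dX: "frechet_derivative (X \<circ> \<psi>) (at u) = (\<lambda>v. T (N (\<psi> u)) (P u v))" if "u \<in> U" for u
    using chart_deriv[OF c(1) that] by (auto simp: P_def)
  have contP: "continuous_on U (\<lambda>u. P u v)" for v
    unfolding P_def
    by (intro bounded_linear.continuous_on[OF bounded_linear_tproj] continuous_at_imp_continuous_on
        ballI differentiable_imp_continuous_within smooth_onD(2)[OF chart(4)[OF c(1)]])
  obtain k d where k: "0 < d" "continuous_on (ball (F p) d) k" "k (F p) = u"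
      "\<And>z. z \<in> ball (F p) d \<Longrightarrow> k z \<in> U \<and> F (\<psi> (k z)) = z" "open (k ` ball (F p) d)"
      "\<And>z. z \<in> ball (F p) d \<Longrightarrow> (k has_derivative inv (P (k z))) (at z)"
    by (rule invertible_derivative_local_inverse[OF chart(1)[OF c(1)] c(2) dF(1) contP dF(2),
          unfolded o_def c(3)]) (assumption, assumption, rule that, assumption+)
  define g where "g = \<psi> \<circ> k"
  note hom = chart(3)[OF c(1)]
  show thesis
  proof
    have "g ` ball (F p) d = \<psi> ` (k ` ball (F p) d)" by (simp add: g_def image_comp)
    also have "\<dots> = \<psi> ` U \<inter> inv_into U \<psi> -` (k ` ball (F p) d)"
    proof (intro equalityI subsetI)
      fix z assume "z \<in> \<psi> ` (k ` ball (F p) d)"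
      then obtain x where x: "x \<in> k ` ball (F p) d" "z = \<psi> x" by blast
      then have "x \<in> U" using k(4) by auto
      then show "z \<in> \<psi> ` U \<inter> inv_into U \<psi> -` (k ` ball (F p) d)"
        using x homeomorphism_apply1[OF hom] by auto
    next
      fix z assume z: "z \<in> \<psi> ` U \<inter> inv_into U \<psi> -` (k ` ball (F p) d)"
      then have "z = \<psi> (inv_into U \<psi> z)" by (simp add: f_inv_into_f)
      then show "z \<in> \<psi> ` (k ` ball (F p) d)" using z by blast
    qed
    also have "open \<dots>"
      by (intro continuous_open_preimage homeomorphism_cont2[OF hom] chart(2)[OF c(1)] k(5))
    finally have "open (g ` ball (F p) d)" .
    moreover have "continuous_on (ball (F p) d) g"
      unfolding g_def o_def by (rule continuous_on_compose2[OF homeomorphism_cont1[OF hom] k(2)]) (use k(4) in auto)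
    ultimately show "local_section F p g d"
      using k c(3) by (simp add: local_section_def g_def)
  next
    fix z assume z: "z \<in> ball (F p) d"
    then have kz: "k z \<in> U" using k(4) by blast
    have "surj (P (k z))"
      using dF(2)[OF kz] has_derivative_linear[OF dF(1)[OF kz]] by (simp add: linear_injective_imp_surjective)
    then have inv: "P (k z) (inv (P (k z)) v) = v" for v by (rule surj_f_inv_f)
    have "(X \<circ> \<psi> \<circ> k has_derivative frechet_derivative (X \<circ> \<psi>) (at (k z)) \<circ> inv (P (k z))) (at z)"
      by (rule diff_chain_at[OF k(6)[OF z] smooth_onD(1)[OF chart(4)[OF c(1)] kz]])
    then show "(X \<circ> g has_derivative T (N (g z))) (at z)"
      unfolding dX[OF kz] by (simp add: g_def o_def inv cong: if_cong)
    have "(N \<circ> \<psi> \<circ> k has_derivative frechet_derivative (N \<circ> \<psi>) (at (k z)) \<circ> inv (P (k z))) (at z)"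
      by (rule diff_chain_at[OF k(6)[OF z] smooth_onD(1)[OF chart(5)[OF c(1)] kz]])
    then show "(N \<circ> g) differentiable (at z)"
      unfolding g_def o_assoc by (rule differentiableI)
  qed
qed

sublocale locally_sectioned F
  by unfold_locales (metis ex_graph_section)

text \<open>By uniqueness of lifts, a continuous section coincides near \<open>z\<close> with a
  section from \<open>ex_graph_section\<close> and inherits its differentiability.\<close>

lemma section_derivative:
  assumes s: "open S" "continuous_on S s" "\<And>z. z \<in> S \<Longrightarrow> F (s z) = z" and z: "z \<in> S"
  shows "(X \<circ> s has_derivative T (N (s z))) (at z)" "(N \<circ> s) differentiable (at z)"
proof -
  obtain g d where g: "local_section F (s z) g d"
    "\<And>x. x \<in> ball (F (s z)) d \<Longrightarrow> (X \<circ> g has_derivative T (N (g x))) (at x)"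
    "\<And>x. x \<in> ball (F (s z)) d \<Longrightarrow> (N \<circ> g) differentiable (at x)" by (rule ex_graph_section) blast
  have Fz: "F (s z) = z" using s z by simp
  obtain e where e: "0 < e" "ball z e \<subseteq> S" using s(1) z openE by blast
  define B where "B = ball z (min d e)"
  have B: "open B" "z \<in> B" "B \<subseteq> S" "B \<subseteq> ball (F (s z)) d" "connected B"
    using e g(1) by (auto simp: B_def Fz local_section_def)
  have eq: "g x = s x" if "x \<in> B" for x
  proof (rule lifts_agree[OF B(5)])
    show "continuous_on B g" using g(1) B(4) by (auto simp: local_section_def elim: continuous_on_subset)
    show "continuous_on B s" using s(2) B(3) by (rule continuous_on_subset)
    show "F (g x) = F (s x)" if "x \<in> B" for x
      using that B(3,4) s(3) g(1) by (auto simp: local_section_def subset_iff)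
    show "g z = s z" using g(1) Fz by (simp add: local_section_def)
  qed (use B that in auto)
  have zB: "z \<in> ball (F (s z)) d" using B by blast
  show "(X \<circ> s has_derivative T (N (s z))) (at z)"
    using g(2)[OF zB] unfolding eq[OF B(2)]
    by (rule has_derivative_transform_within_open[OF _ B(1,2)]) (simp add: eq)
  obtain D where "(N \<circ> g has_derivative D) (at z)" using g(3)[OF zB] by (auto simp: differentiable_def)
  then have "(N \<circ> s has_derivative D) (at z)"
    by (rule has_derivative_transform_within_open[OF _ B(1,2)]) (simp add: eq)
  then show "(N \<circ> s) differentiable (at z)" by (rule differentiableI)
qed

text \<open>Near \<open>t\<close> the lift is a differentiable local section composed with the
  parametrized line, again by uniqueness of lifts.\<close>

lemma lift_derivative:
  assumes \<sigma>: "open J" "continuous_on J \<sigma>" "\<And>t. t \<in> J \<Longrightarrow> F (\<sigma> t) = c + t *\<^sub>R v" and t: "t \<in> J"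
  shows "(X \<circ> \<sigma> has_vector_derivative T (N (\<sigma> t)) v) (at t)"
proof -
  obtain g d where g: "local_section F (\<sigma> t) g d"
    "\<And>x. x \<in> ball (F (\<sigma> t)) d \<Longrightarrow> (X \<circ> g has_derivative T (N (g x))) (at x)" by (rule ex_graph_section) blast
  define h where "h = (\<lambda>t. c + t *\<^sub>R v)"
  have h: "continuous_on K h" for K unfolding h_def by (intro continuous_intros)
  have Ft: "F (\<sigma> t) = h t" using \<sigma> t by (simp add: h_def)
  have "open (h -` ball (h t) d)" by (rule open_vimage[OF open_ball h])
  then have "open (J \<inter> h -` ball (h t) d)" using \<sigma>(1) by blast
  moreover have "t \<in> J \<inter> h -` ball (h t) d" using t g(1) by (simp add: local_section_def)
  ultimately obtain e where e: "0 < e" "ball t e \<subseteq> J \<inter> h -` ball (h t) d" using openE by blast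
  have eq: "g (h r) = \<sigma> r" if "r \<in> ball t e" for r
  proof (rule lifts_agree[of "ball t e" "\<lambda>r. g (h r)" \<sigma> t])
    show "continuous_on (ball t e) (\<lambda>r. g (h r))"
      by (rule continuous_on_compose2[OF _ h, of "ball (F (\<sigma> t)) d"])
        (use g(1) e(2) in \<open>auto simp: local_section_def Ft\<close>)
    show "continuous_on (ball t e) \<sigma>" using \<sigma>(2) e(2) continuous_on_subset by blast
    show "F (g (h r)) = F (\<sigma> r)" if "r \<in> ball t e" for r
    proof -
      have "r \<in> J" "h r \<in> ball (F (\<sigma> t)) d" using that e(2) Ft by auto
      then show ?thesis using \<sigma>(3) g(1) by (simp add: local_section_def h_def)
    qed
    show "g (h t) = \<sigma> t" using g(1) Ft by (simp add: local_section_def)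
  qed (use that e in auto)
  have "h t \<in> ball (F (\<sigma> t)) d" using Ft g(1) by (simp add: local_section_def)
  from g(2)[OF this] have 1: "(X \<circ> g has_derivative T (N (g (h t)))) (at (h t))" .
  have "(h has_derivative (\<lambda>r. r *\<^sub>R v)) (at t)"
    unfolding h_def by (auto intro!: derivative_eq_intros)
  from diff_chain_at[OF this 1]
  have "(X \<circ> g \<circ> h has_derivative T (N (g (h t))) \<circ> (\<lambda>r. r *\<^sub>R v)) (at t)" .
  then have "(X \<circ> g \<circ> h has_vector_derivative T (N (\<sigma> t)) v) (at t)"
    using eq[of t] e(1) unfolding has_vector_derivative_def
    by (simp add: o_def linear_scale[OF bounded_linear.linear[OF bounded_linear_tlift]])
  then show ?thesis
    by (rule has_vector_derivative_transform_within_open[OF _ open_ball, of _ _ _ t e]) (use eq e in auto)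
qed

text \<open>The velocity of the lift is \<open>T (N (\<gamma> t)) v\<close>, which is continuous and
  of norm at most \<open>norm v / (2 * \<epsilon>)\<close>. The end points are exceptional
  parameters because the lift is controlled on \<open>{0..1}\<close> only.\<close>

lemma lift_path_length:
  assumes \<gamma>: "path \<gamma>" "\<And>t. t \<in> {0..1} \<Longrightarrow> F (\<gamma> t) = c + t *\<^sub>R v"
  shows "\<exists>L. path_length X \<gamma> (\<gamma> 0) (\<gamma> 1) L \<and> L \<le> norm v / (2 * \<epsilon>)"
proof -
  define D where "D = (\<lambda>t. T (N (\<gamma> t)) v)"
  have c\<gamma>: "continuous_on {0..1} \<gamma>" using \<gamma>(1) by (simp add: path_def)
  have cD: "continuous_on {0..1} D"
    unfolding D_def using c\<gamma> N_y(2)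
    by (intro continuous_on_T continuous_on_compose2[OF continuous_N[of UNIV]]) auto
  have d: "(X \<circ> \<gamma> has_vector_derivative D t) (at t)" if "t \<in> {0<..<1}" for t
    unfolding D_def
    by (rule lift_derivative[of "{0<..<1}"]) (use that \<gamma>(2) c\<gamma> in \<open>auto elim: continuous_on_subset\<close>)
  define L where "L = integral {0..1} (\<lambda>t. norm (D t))"
  have L: "((\<lambda>t. norm (D t)) has_integral L) {0..1}"
    unfolding L_def by (intro integrable_integral integrable_continuous_real continuous_intros cD)
  have "((\<lambda>t. norm (vector_derivative (X \<circ> \<gamma>) (at t))) has_integral L) {0..1}"
  proof (rule has_integral_spike_finite[of "{0, 1}", OF _ _ L])
    show "norm (vector_derivative (X \<circ> \<gamma>) (at t)) = norm (D t)" if "t \<in> {0..1} - {0, 1}" for t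
      using vector_derivative_at[OF d[of t]] that by auto
  qed simp
  moreover have "valid_path (X \<circ> \<gamma>)"
    unfolding valid_path_def piecewise_C1_differentiable_on_def
  proof (intro conjI exI[of _ "{0, 1}"])
    show "continuous_on {0..1} (X \<circ> \<gamma>)"
      using c\<gamma> continuous_X by (rule continuous_on_compose)
    show "X \<circ> \<gamma> C1_differentiable_on {0..1} - {0, 1}"
      unfolding C1_differentiable_on_def
      by (rule exI[of _ D]) (use d cD in \<open>auto elim: continuous_on_subset\<close>)
  qed simp
  moreover have "L \<le> norm v / (2 * \<epsilon>)"
  proof (rule has_integral_le[OF L])
    show "((\<lambda>t::real. norm v / (2 * \<epsilon>)) has_integral norm v / (2 * \<epsilon>)) {0..1}"
      using has_integral_const_real[of "norm v / (2 * \<epsilon>)" 0 1] by simp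
    show "norm (D t) \<le> norm v / (2 * \<epsilon>)" for t
      unfolding D_def by (rule norm_T_le[OF norm_N steep \<epsilon>])
  qed
  ultimately show ?thesis using \<gamma>(1) by (auto simp: path_length_def pathstart_def pathfinish_def)
qed

text \<open>Being joined by a rectifiable curve is transitive, and it relates any two points in the
  image of a local section, since segments of the ball lift. Connectedness then joins all points, so
  every induced distance is the infimum of a nonempty set.\<close>

lemma ex_path_length: "\<exists>\<gamma> L. path_length X \<gamma> p q L"
proof -
  define J where "J = (\<lambda>p q. \<exists>\<gamma> L. path_length X \<gamma> p q L)"
  have trans: "J p r" if "J p q" "J q r" for p q r
    using that unfolding J_def using path_length_join by blast
  have conn: "connected (UNIV :: 'm set)" using surface by (simp add: oriented_immersed_surface_def)
  \<comment> \<open>Asking for both directions makes the relation symmetric without reversing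
    curves.\<close>
  have "J p q \<and> J q p"
  proof (rule connected_equivalence_relation[OF conn, of p q "\<lambda>p q. J p q \<and> J q p"])
    fix a :: 'm
    obtain g d where g: "local_section F a g d" using ex_local_section by blast
    have J: "J (g z) (g w)" if zw: "z \<in> ball (F a) d" "w \<in> ball (F a) d" for z w
    proof -
      define \<gamma> where "\<gamma> = g \<circ> linepath z w"
      have in_ball: "linepath z w t \<in> ball (F a) d" if "t \<in> {0..1}" for t
        using that zw by (metis closed_segment_subset convex_ball linepath_in_path subset_iff)
      have "path \<gamma>" unfolding \<gamma>_def path_def o_def
        by (rule continuous_on_compose2[OF _ continuous_on_linepath, of "ball (F a) d"])
          (use g in_ball in \<open>auto simp: local_section_def\<close>)
      moreover have "F (\<gamma> t) = z + t *\<^sub>R (w - z)" if "t \<in> {0..1}" for t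
        using in_ball[OF that] g by (simp add: \<gamma>_def local_section_def linepath_def algebra_simps)
      ultimately have "J (\<gamma> 0) (\<gamma> 1)" using lift_path_length[of \<gamma> z "w - z"] unfolding J_def by blast
      then show ?thesis by (simp add: \<gamma>_def linepath_def)
    qed
    have a: "a = g (F a)" "F a \<in> ball (F a) d" using g by (auto simp: local_section_def)
    have "\<forall>x\<in>g ` ball (F a) d. J a x \<and> J x a" using J[OF a(2)] J[OF _ a(2)] a(1) by auto
    moreover have "openin (top_of_set UNIV) (g ` ball (F a) d)" using g by (simp add: local_section_def)
    moreover have "a \<in> g ` ball (F a) d" using a by blast
    ultimately show "\<exists>T. openin (top_of_set UNIV) T \<and> a \<in> T \<and> (\<forall>x\<in>T. J a x \<and> J x a)" by blast
  qed (use trans in blast)+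
  then show ?thesis by (simp add: J_def)
qed

section \<open>Induced distance under the projection, and lifting of segments\<close>

lemma dist_F_le: "dist (F p) (F q) \<le> dist (X p) (X q)"
  using norm_Q_le[of "X p - X q"]
  by (simp add: dist_norm linear_diff[OF bounded_linear.linear[OF bounded_linear_tproj]])

text \<open>A curve is at least as long as its chord, and the projection shortens chords.
  Convergence in the induced distance therefore implies convergence of the projections.\<close>

lemma dist_F_le_induced_dist: "dist (F p) (F q) \<le> induced_dist X p q"
proof (rule ccontr)
  assume "\<not> ?thesis"
  then obtain \<gamma> L where \<gamma>: "path_length X \<gamma> p q L" "L < dist (F p) (F q)"
    using ex_path_length induced_dist_less_path by (metis not_le)
  then have "dist (X (\<gamma> 0)) (X q) \<le> L" by (intro path_length_ge_dist) auto
  then show False using \<gamma> dist_F_le[of p q] by (simp add: path_length_def pathstart_def)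
qed

text \<open>A curve from \<open>p\<close> to \<open>l\<close> shorter than \<open>d\<close> projects
  into the ball. It and the lift of its projection by \<open>g\<close> agree at the end
  \<open>l\<close>, hence along the whole curve and at \<open>p\<close>.\<close>

lemma induced_dist_near:
  assumes g: "local_section F l g d" and p: "induced_dist X p l < d"
  shows "F p \<in> ball (F l) d" "g (F p) = p"
proof -
  obtain \<gamma> L where \<gamma>: "path_length X \<gamma> p l L" "L < d"
    using ex_path_length induced_dist_less_path[OF _ p] by metis
  have in_ball: "F (\<gamma> t) \<in> ball (F l) d" if "t \<in> {0..1}" for t
    using path_length_ge_dist[OF \<gamma>(1) that] \<gamma>(2) dist_F_le[of "\<gamma> t" l] by (simp add: dist_commute)
  have ends: "\<gamma> 0 = p" "\<gamma> 1 = l" and c\<gamma>: "continuous_on {0..1} \<gamma>"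
    using \<gamma>(1) by (auto simp: path_length_def pathstart_def pathfinish_def path_def)
  then show "F p \<in> ball (F l) d" using in_ball[of 0] by simp
  have cF: "continuous_on UNIV F" by (intro bounded_linear.continuous_on[OF bounded_linear_tproj] continuous_X)
  have "g (F (\<gamma> 0)) = \<gamma> 0"
  proof (rule lifts_agree[of "{0..1::real}" "\<lambda>t. g (F (\<gamma> t))" \<gamma> 1])
    have "continuous_on {0..1} (\<lambda>t. F (\<gamma> t))"
      by (rule continuous_on_compose2[OF cF c\<gamma>]) simp
    then show "continuous_on {0..1} (\<lambda>t. g (F (\<gamma> t)))"
      by (rule continuous_on_compose2[of "ball (F l) d" g, rotated])
        (use g in_ball in \<open>auto simp: local_section_def\<close>)
  qed (use g in_ball c\<gamma> ends in \<open>auto simp: local_section_def\<close>)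
  then show "g (F p) = p" by (simp add: ends)
qed

text \<open>This is where completeness is used. The lift is Lipschitz for the induced distance,
  hence Cauchy as the parameter tends to \<open>\<tau>\<close>. The limit \<open>l\<close> lies over
  the end of the segment, and near \<open>l\<close> the lift runs in the image of a local
  section.\<close>

lemma segment_lift_extends:
  assumes \<tau>: "0 < \<tau>" and \<sigma>: "continuous_on {0..<\<tau>} \<sigma>"
    and line: "\<forall>t\<in>{0..<\<tau>}. F (\<sigma> t) = a + t *\<^sub>R (b - a)"
  shows "\<exists>l g d t. local_section F l g d \<and> F l = a + \<tau> *\<^sub>R (b - a) \<and> t \<in> {0..<\<tau>} \<and>
        a + t *\<^sub>R (b - a) \<in> ball (F l) d \<and> \<sigma> t = g (a + t *\<^sub>R (b - a))"
proof -
  \<comment> \<open>The summand 1 keeps the Lipschitz constant positive when \<open>a = b\<close>,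
    so that one can divide by it.\<close>
  define K where "K = norm (b - a) / (2 * \<epsilon>) + 1"
  have "K > 0" using \<epsilon> by (simp add: K_def add_nonneg_pos)
  have lip: "induced_dist X (\<sigma> r) (\<sigma> t) \<le> K * \<bar>t - r\<bar>" if rt: "r \<in> {0..<\<tau>}" "t \<in> {0..<\<tau>}" for r t
  proof -
    define \<gamma> where "\<gamma> = \<sigma> \<circ> linepath r t"
    have in_J: "linepath r t x \<in> {0..<\<tau>}" if "x \<in> {0..1}" for x
    proof -
      have "linepath r t x \<in> closed_segment r t" using that by (rule linepath_in_path)
      also have "\<dots> \<subseteq> {0..<\<tau>}" using rt by (intro closed_segment_subset) auto
      finally show ?thesis .
    qed
    have "path \<gamma>" unfolding \<gamma>_def path_def o_def
      by (rule continuous_on_compose2[OF \<sigma> continuous_on_linepath]) (use in_J in auto)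
    moreover have "F (\<gamma> x) = (a + r *\<^sub>R (b - a)) + x *\<^sub>R ((t - r) *\<^sub>R (b - a))" if "x \<in> {0..1}" for x
      using line in_J[OF that] by (simp add: \<gamma>_def) (simp add: linepath_def algebra_simps)
    ultimately obtain L where "path_length X \<gamma> (\<gamma> 0) (\<gamma> 1) L" "L \<le> norm ((t - r) *\<^sub>R (b - a)) / (2 * \<epsilon>)"
      using lift_path_length by blast
    then have "induced_dist X (\<sigma> r) (\<sigma> t) \<le> norm ((t - r) *\<^sub>R (b - a)) / (2 * \<epsilon>)"
      using induced_dist_le[of X \<gamma> "\<gamma> 0" "\<gamma> 1" L] by (simp add: \<gamma>_def linepath_def)
    also have "\<dots> = norm (b - a) / (2 * \<epsilon>) * \<bar>t - r\<bar>" by simp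
    also have "\<dots> \<le> K * \<bar>t - r\<bar>" by (intro mult_right_mono) (auto simp: K_def)
    finally show ?thesis .
  qed
  define t where "t = (\<lambda>n. \<tau> * (1 - inverse (real (Suc n))))"
  have t: "t n \<in> {0..<\<tau>}" for n
    using \<tau> by (auto simp: t_def field_simps)
  have "t \<longlonglongrightarrow> \<tau> * (1 - 0)"
    unfolding t_def by (intro tendsto_intros LIMSEQ_inverse_real_of_nat)
  then have tlim: "t \<longlonglongrightarrow> \<tau>" by simp
  have "\<forall>e>0. \<exists>k. \<forall>m\<ge>k. \<forall>n\<ge>k. induced_dist X (\<sigma> (t m)) (\<sigma> (t n)) < e"
  proof (intro allI impI)
    fix e :: real assume "e > 0"
    then obtain k where k: "\<And>m n. m \<ge> k \<Longrightarrow> n \<ge> k \<Longrightarrow> dist (t m) (t n) < e / K"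
      using LIMSEQ_imp_Cauchy[OF tlim] \<open>K > 0\<close> unfolding Cauchy_def by (meson divide_pos_pos)
    have "induced_dist X (\<sigma> (t m)) (\<sigma> (t n)) < e" if "m \<ge> k" "n \<ge> k" for m n
    proof -
      have "K * \<bar>t n - t m\<bar> < e"
        using k[OF that(2,1)] \<open>K > 0\<close> by (simp add: dist_real_def field_simps)
      then show ?thesis using lip[OF t t, of m n] by linarith
    qed
    then show "\<exists>k. \<forall>m\<ge>k. \<forall>n\<ge>k. induced_dist X (\<sigma> (t m)) (\<sigma> (t n)) < e" by blast
  qed
  then obtain l where l: "(\<lambda>n. induced_dist X (\<sigma> (t n)) l) \<longlonglongrightarrow> 0"
    using complete[unfolded complete_surface_def, rule_format, of "\<lambda>n. \<sigma> (t n)"] by blast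
  have "(\<lambda>n. dist (F (\<sigma> (t n))) (F l)) \<longlonglongrightarrow> 0"
    by (rule tendsto_sandwich[OF _ _ tendsto_const l]) (simp_all add: dist_F_le_induced_dist)
  then have "(\<lambda>n. F (\<sigma> (t n))) \<longlonglongrightarrow> F l" by (rule tendsto_dist_iff[THEN iffD2])
  moreover have "(\<lambda>n. F (\<sigma> (t n))) = (\<lambda>n. a + t n *\<^sub>R (b - a))" using line t by blast
  ultimately have "(\<lambda>n. a + t n *\<^sub>R (b - a)) \<longlonglongrightarrow> F l" by simp
  moreover have "(\<lambda>n. a + t n *\<^sub>R (b - a)) \<longlonglongrightarrow> a + \<tau> *\<^sub>R (b - a)"
    by (intro tendsto_intros tlim)
  ultimately have Fl: "F l = a + \<tau> *\<^sub>R (b - a)" by (rule LIMSEQ_unique)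
  obtain g d where g: "local_section F l g d" using ex_local_section by blast
  then have "0 < d" by (simp add: local_section_def)
  then have "eventually (\<lambda>n. induced_dist X (\<sigma> (t n)) l < d) sequentially"
    using l order_tendstoD(2) by blast
  then obtain n where n: "induced_dist X (\<sigma> (t n)) l < d" by (auto simp: eventually_sequentially)
  have "F (\<sigma> (t n)) = a + t n *\<^sub>R (b - a)" using line t by blast
  then show ?thesis using induced_dist_near[OF g n] g Fl t[of n] by metis
qed

text \<open>A section whose range is everything is a two-sided inverse of \<open>F\<close>: the
  surface is a graph over the whole plane.\<close>

lemma entire_section:
  obtains s where "continuous_on UNIV s" "\<And>z. F (s z) = z" "\<And>p. s (F p) = p"
proof -
  obtain s where s: "continuous_on UNIV s" "\<forall>z. F (s z) = z"
    using global_section[OF segment_lift_extends] by blast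
  have "range s = UNIV"
    using surface s by (intro global_section_surj) (auto simp: oriented_immersed_surface_def)
  then have "s (F p) = p" for p using s(2) by (metis rangeE UNIV_I)
  then show thesis using that s by blast
qed

end

subsection \<open>Curvature of the graph\<close>

text \<open>Both identities follow from \<open>I ** S = h\<close>. The right-hand side of the first
  is the trace of the adjugate of \<open>I\<close> times \<open>h\<close>, so no entry of the
  inverse has to be computed.\<close>

lemma matrix_inv_mult_2x2:
  fixes I h :: "real^2^2"
  assumes "det I \<noteq> 0"
  defines "S \<equiv> matrix_inv I ** h"
  shows "det I * trace S = I$2$2 * h$1$1 - I$1$2 * h$2$1 - I$2$1 * h$1$2 + I$1$1 * h$2$2"
    "det I * det S = det h"
proof -
  have "invertible I" using assms by (simp add: invertible_det_nz)
  then have "I ** matrix_inv I = mat 1"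
    unfolding invertible_def matrix_inv_def by (rule someI2_ex) blast
  then have IS: "I ** S = h" by (simp add: S_def matrix_mul_assoc)
  then show "det I * det S = det h" by (metis det_mul)
  have "h $ i $ j = I$i$1 * S$1$j + I$i$2 * S$2$j" for i j
    unfolding IS[symmetric] by (simp add: matrix_matrix_mult_def sum_2)
  then show "det I * trace S = I$2$2 * h$1$1 - I$1$2 * h$2$1 - I$2$1 * h$1$2 + I$1$1 * h$2$2"
    by (simp add: trace_def sum_2 det_2 algebra_simps)
qed

context steep_surface
begin

text \<open>The gradient of the function whose graph is the surface, read off from the normal;
  \<open>height_has_derivative\<close> confirms this.\<close>

definition slope :: "'m \<Rightarrow> real^2" where
  "slope p = - (1 / (N p \<bullet> y)) *\<^sub>R Q (N p)"

text \<open>The Hessian of the graph function applied to \<open>w\<close>, obtained from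
  \<open>slope\<close> by the quotient rule with \<open>m\<close> as the derivative of the
  normal.\<close>

definition curv :: "(real^2 \<Rightarrow> 'm) \<Rightarrow> real^2 \<Rightarrow> real^2 \<Rightarrow> real^2" where
  "curv s z w = (let m = frechet_derivative (N \<circ> s) (at z) w; n = N (s z) in
     - (1 / (n \<bullet> y)) *\<^sub>R Q m + ((m \<bullet> y) / (n \<bullet> y)\<^sup>2) *\<^sub>R Q n)"

lemma slope_has_derivative:
  assumes s: "continuous_on UNIV s" "\<And>z. F (s z) = z"
  shows "((\<lambda>z. slope (s z)) has_derivative curv s z) (at z)"
proof -
  define m where "m = frechet_derivative (N \<circ> s) (at z)"
  have "(N \<circ> s has_derivative m) (at z)"
    unfolding m_def using section_derivative(2)[OF open_UNIV s UNIV_I] by (simp add: frechet_derivative_works)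
  then have m: "((\<lambda>z. N (s z)) has_derivative m) (at z)" by (simp add: o_def)
  have 1: "((\<lambda>z. Q (N (s z))) has_derivative (\<lambda>w. Q (m w))) (at z)"
    by (rule bounded_linear.has_derivative[OF bounded_linear_tproj m])
  have 2: "((\<lambda>z. N (s z) \<bullet> y) has_derivative (\<lambda>w. m w \<bullet> y)) (at z)"
    by (rule has_derivative_inner_left[OF m])
  have 3: "((\<lambda>z. - (1 / (N (s z) \<bullet> y))) has_derivative (\<lambda>w. (m w \<bullet> y) / (N (s z) \<bullet> y)\<^sup>2)) (at z)"
    unfolding divide_inverse mult_1
    by (rule has_derivative_eq_rhs[OF has_derivative_minus[OF Deriv.has_derivative_inverse[OF N_y(2) 2]]])
      (simp add: power2_eq_square ac_simps)
  show ?thesis unfolding slope_def curv_def Let_def m_def[symmetric]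
    by (rule has_derivative_eq_rhs[OF has_derivative_scaleR[OF 3 1]]) (simp add: fun_eq_iff)
qed

lemma height_has_derivative:
  assumes s: "continuous_on UNIV s" "\<And>z. F (s z) = z"
  shows "((\<lambda>z. X (s z) \<bullet> y) has_derivative (\<lambda>w. slope (s z) \<bullet> w)) (at z)"
proof -
  have "((\<lambda>z. X (s z)) has_derivative T (N (s z))) (at z)"
    using section_derivative(1)[OF open_UNIV s UNIV_I] by (simp add: o_def)
  from has_derivative_inner_left[OF this, of y] show ?thesis
    by (rule has_derivative_eq_rhs) (simp add: fun_eq_iff T_y slope_def, simp add: inner_commute)
qed

text \<open>Differentiating the tangency relation \<open>pd j ?r \<bullet> ?\<nu> = 0\<close> moves
  the second derivative of the immersion onto the normal, and
  \<open>second_fundamental_identity\<close> then produces the Hessian. Both forms are those of the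
  graph, pulled back by the derivative \<open>P\<close> of \<open>F \<circ> \<psi>\<close>.\<close>

lemma second_form_section:
  assumes s: "continuous_on UNIV s" "\<And>z. F (s z) = z" "\<And>p. s (F p) = p"
    and c: "(U, \<psi>) \<in> A" "u \<in> U"
  defines "P \<equiv> \<lambda>v. Q (frechet_derivative (X \<circ> \<psi>) (at u) v)"
  shows "second_form (X \<circ> \<psi>) (N \<circ> \<psi>) u $ i $ j =
      (N (\<psi> u) \<bullet> y) * (P (axis j 1) \<bullet> curv s (F (\<psi> u)) (P (axis i 1)))"
    "first_form (X \<circ> \<psi>) u $ i $ j = P (axis i 1) \<bullet> P (axis j 1)
      + (P (axis i 1) \<bullet> slope (\<psi> u)) * (P (axis j 1) \<bullet> slope (\<psi> u))"
proof -
  let ?r = "X \<circ> \<psi>" and ?\<nu> = "N \<circ> \<psi>" and ?n = "N (\<psi> u)" and ?z = "F (\<psi> u)"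
  note U = chart(1)[OF c(1)]
  have P: "(F \<circ> \<psi> has_derivative P) (at u)" "frechet_derivative ?r (at u) = (\<lambda>v. T ?n (P v))"
    unfolding P_def using chart_deriv(1,3)[OF c] by auto
  have pd: "pd i ?r u = T ?n (P (axis i 1))" for i by (simp add: pd_def P(2))
  define m where "m = frechet_derivative (N \<circ> s) (at ?z)"
  have "(N \<circ> s has_derivative m) (at ?z)"
    unfolding m_def using section_derivative(2)[OF open_UNIV s(1,2) UNIV_I] by (simp add: frechet_derivative_works)
  from diff_chain_at[OF P(1), unfolded o_def, OF this[unfolded o_def]]
  have d\<nu>: "(?\<nu> has_derivative (\<lambda>v. m (P v))) (at u)" by (simp add: s(3) o_def)
  have "(pd j ?r has_derivative frechet_derivative (pd j ?r) (at u)) (at u)"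
    using smooth_onD(2)[OF chart(4)[OF c(1)] c(2)] by (simp add: pd_def[abs_def] frechet_derivative_works)
  from has_derivative_inner[OF this d\<nu>]
  have "((\<lambda>x. pd j ?r x \<bullet> ?\<nu> x) has_derivative
      (\<lambda>v. pd j ?r u \<bullet> m (P v) + frechet_derivative (pd j ?r) (at u) v \<bullet> ?n)) (at u)" by simp
  moreover have "((\<lambda>x. pd j ?r x \<bullet> ?\<nu> x) has_derivative (\<lambda>v. 0)) (at u)"
    by (rule has_derivative_transform_within_open[OF has_derivative_const[of 0] U c(2)])
      (simp add: pd_def chart(7)[OF c(1)])
  ultimately have "(\<lambda>v. pd j ?r u \<bullet> m (P v) + frechet_derivative (pd j ?r) (at u) v \<bullet> ?n) = (\<lambda>v. 0)"
    by (rule has_derivative_unique)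
  from fun_cong[OF this, of "axis i 1"]
  have "pd i (pd j ?r) u \<bullet> ?n = - (T ?n (P (axis j 1)) \<bullet> m (P (axis i 1)))"
    by (simp add: pd pd_def[of i "pd j ?r"])
  also have "\<dots> = (?n \<bullet> y) * (P (axis j 1) \<bullet> curv s ?z (P (axis i 1)))"
    unfolding second_fundamental_identity[OF N_y(2)] by (simp add: curv_def Let_def m_def s(3))
  finally show "second_form ?r ?\<nu> u $ i $ j = (?n \<bullet> y) * (P (axis j 1) \<bullet> curv s ?z (P (axis i 1)))"
    using norm_N[of "\<psi> u"] by (simp add: second_form_def vector_second_form_def normal_part_def norm_eq_1)
  show "first_form ?r u $ i $ j = P (axis i 1) \<bullet> P (axis j 1)
      + (P (axis i 1) \<bullet> slope (\<psi> u)) * (P (axis j 1) \<bullet> slope (\<psi> u))"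
    unfolding first_form_def
    by (simp add: pd) (subst inner_decomp, simp add: Q_T T_y slope_def)
qed

text \<open>The classical formulas for graphs, evaluated in an arbitrary chart. The pullback by
  \<open>P\<close> multiplies both sides by the square of \<open>J\<close>, the determinant of
  \<open>P\<close>, which is nonzero and cancels.\<close>

lemma curvature_section:
  assumes s: "continuous_on UNIV s" "\<And>z. F (s z) = z" "\<And>p. s (F p) = p"
    and c: "(U, \<psi>) \<in> A" "u \<in> U"
  defines "z \<equiv> F (\<psi> u)"
  defines "a \<equiv> slope (\<psi> u) $ 1" and "b \<equiv> slope (\<psi> u) $ 2"
    and "p \<equiv> curv s z (axis 1 1) $ 1" and "q \<equiv> curv s z (axis 1 1) $ 2" and "r \<equiv> curv s z (axis 2 1) $ 2"
  shows "(1 + a * a + b * b) * gauss_curvature (X \<circ> \<psi>) (N \<circ> \<psi>) u = (N (\<psi> u) \<bullet> y)\<^sup>2 * (p * r - q * q)"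
    "(1 + a * a + b * b) * mean_curvature (X \<circ> \<psi>) (N \<circ> \<psi>) u =
      (N (\<psi> u) \<bullet> y) * ((1 + b * b) * p - 2 * a * b * q + (1 + a * a) * r)"
proof -
  define P where "P = (\<lambda>v. Q (frechet_derivative (X \<circ> \<psi>) (at u) v))"
  have P_eq: "Q (frechet_derivative (X \<circ> \<psi>) (at u) v) = P v" for v by (simp add: P_def)
  define I where "I = first_form (X \<circ> \<psi>) u"
  define h where "h = second_form (X \<circ> \<psi>) (N \<circ> \<psi>) u"
  define \<nu> where "\<nu> = N (\<psi> u) \<bullet> y"
  have P: "(F \<circ> \<psi> has_derivative P) (at u)" "inj P"
    unfolding P_def using chart_deriv(1,2)[OF c] by auto
  have sym: "curv s z (axis 2 1) $ 1 = q"
    using symmetric_second_derivative[OF height_has_derivative[OF s(1,2)] slope_has_derivative[OF s(1,2)],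
        of z "axis 1 1" "axis 2 1"]
    by (simp add: q_def inner_axis)
  have curv: "curv s z v = vector [p * v $ 1 + q * v $ 2, q * v $ 1 + r * v $ 2]" for v
    using linear_real2[OF has_derivative_linear[OF slope_has_derivative[OF s(1,2), of z]], of v] sym
    by (simp add: vec_eq_iff forall_2 p_def q_def r_def)
  define \<alpha> where "\<alpha> = P (axis 1 1) $ 1"
  define \<gamma> where "\<gamma> = P (axis 1 1) $ 2"
  define \<beta> where "\<beta> = P (axis 2 1) $ 1"
  define \<delta> where "\<delta> = P (axis 2 1) $ 2"
  define J where "J = \<alpha> * \<delta> - \<beta> * \<gamma>"
  have "det (matrix P) \<noteq> 0" using P has_derivative_linear det_nz_iff_inj by blast
  then have J: "J \<noteq> 0" by (simp add: J_def \<alpha>_def \<beta>_def \<gamma>_def \<delta>_def det_2 matrix_def)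
  have I: "I $ 1 $ 1 = \<alpha> * \<alpha> + \<gamma> * \<gamma> + (\<alpha> * a + \<gamma> * b) * (\<alpha> * a + \<gamma> * b)"
    "I $ 1 $ 2 = \<alpha> * \<beta> + \<gamma> * \<delta> + (\<alpha> * a + \<gamma> * b) * (\<beta> * a + \<delta> * b)"
    "I $ 2 $ 1 = \<alpha> * \<beta> + \<gamma> * \<delta> + (\<alpha> * a + \<gamma> * b) * (\<beta> * a + \<delta> * b)"
    "I $ 2 $ 2 = \<beta> * \<beta> + \<delta> * \<delta> + (\<beta> * a + \<delta> * b) * (\<beta> * a + \<delta> * b)"
    unfolding I_def second_form_section(2)[OF s c]
    by (simp_all add: P_eq inner_real2 a_def b_def \<alpha>_def \<beta>_def \<gamma>_def \<delta>_def)
  have h: "h $ 1 $ 1 = \<nu> * (\<alpha> * (p * \<alpha> + q * \<gamma>) + \<gamma> * (q * \<alpha> + r * \<gamma>))"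
    "h $ 1 $ 2 = \<nu> * (\<beta> * (p * \<alpha> + q * \<gamma>) + \<delta> * (q * \<alpha> + r * \<gamma>))"
    "h $ 2 $ 1 = \<nu> * (\<alpha> * (p * \<beta> + q * \<delta>) + \<gamma> * (q * \<beta> + r * \<delta>))"
    "h $ 2 $ 2 = \<nu> * (\<beta> * (p * \<beta> + q * \<delta>) + \<delta> * (q * \<beta> + r * \<delta>))"
    unfolding h_def second_form_section(1)[OF s c] z_def[symmetric]
    by (simp_all add: P_eq inner_real2 curv \<nu>_def \<alpha>_def \<beta>_def \<gamma>_def \<delta>_def)
  have W: "1 + a * a + b * b > 0" by (simp add: add_pos_nonneg)
  have dI: "det I = J\<^sup>2 * (1 + a * a + b * b)"
    unfolding det_2 I J_def by algebra
  then have dI0: "det I \<noteq> 0" using J W by simp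
  have "det I * gauss_curvature (X \<circ> \<psi>) (N \<circ> \<psi>) u = det h"
    unfolding gauss_curvature_def shape_matrix_def I_def[symmetric] h_def[symmetric]
    by (rule matrix_inv_mult_2x2(2)[OF dI0])
  also have "det h = J\<^sup>2 * (\<nu>\<^sup>2 * (p * r - q * q))"
    unfolding det_2 h J_def by algebra
  finally show "(1 + a * a + b * b) * gauss_curvature (X \<circ> \<psi>) (N \<circ> \<psi>) u = (N (\<psi> u) \<bullet> y)\<^sup>2 * (p * r - q * q)"
    unfolding dI \<nu>_def[symmetric] using J by (simp add: mult.assoc)
  have "det I * mean_curvature (X \<circ> \<psi>) (N \<circ> \<psi>) u
      = I$2$2 * h$1$1 - I$1$2 * h$2$1 - I$2$1 * h$1$2 + I$1$1 * h$2$2"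
    unfolding mean_curvature_def shape_matrix_def I_def[symmetric] h_def[symmetric]
    by (rule matrix_inv_mult_2x2(1)[OF dI0])
  also have "\<dots> = J\<^sup>2 * (\<nu> * ((1 + b * b) * p - 2 * a * b * q + (1 + a * a) * r))"
    unfolding h I J_def by algebra
  finally show "(1 + a * a + b * b) * mean_curvature (X \<circ> \<psi>) (N \<circ> \<psi>) u =
      (N (\<psi> u) \<bullet> y) * ((1 + b * b) * p - 2 * a * b * q + (1 + a * a) * r)"
    unfolding dI \<nu>_def[symmetric] using J by (simp add: mult.assoc)
qed

end

section \<open>Derivatives of the weight, constant slope and the plane\<close>

lemma smooth_on_real_deriv:
  fixes \<phi> :: "real \<Rightarrow> real"
  assumes "smooth_on UNIV \<phi>"
  shows "DERIV \<phi> x :> deriv \<phi> x" "DERIV (deriv \<phi>) x :> deriv (deriv \<phi>) x"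
proof -
  have d: "\<phi> differentiable (at x)" for x
    using smooth_onD(1)[OF assms UNIV_I] by (rule differentiableI)
  then show D: "DERIV \<phi> x :> deriv \<phi> x" for x
    by (simp add: DERIV_deriv_iff_real_differentiable)
  have "frechet_derivative \<phi> (at x) = (*) (deriv \<phi> x)" for x
    using D[of x] unfolding has_field_derivative_def by (metis frechet_derivative_at)
  then have "deriv \<phi> = (\<lambda>x. frechet_derivative \<phi> (at x) 1)" by auto
  then have "deriv \<phi> differentiable (at x)" using smooth_onD(2)[OF assms UNIV_I] by metis
  then show "DERIV (deriv \<phi>) x :> deriv (deriv \<phi>) x"
    by (simp add: DERIV_deriv_iff_real_differentiable)
qed

context steep_surface
begin

text \<open>The height along \<open>y\<close> minus the linear function with gradient
  \<open>g\<close> has zero derivative, so the surface fills the level set of \<open>m\<close>, the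
  vector \<open>y\<close> minus \<open>g\<close> carried into space. Injectivity of \<open>X\<close>
  comes from that of \<open>F\<close>.\<close>

lemma plane_if_slope_constant:
  assumes s: "continuous_on UNIV s" "\<And>z. F (s z) = z" "\<And>p. s (F p) = p"
    and const: "\<And>z. slope (s z) = g"
  shows "inj X \<and> affine (range X) \<and> aff_dim (range X) = 2"
proof -
  have "((\<lambda>z. X (s z) \<bullet> y - g \<bullet> z) has_derivative (\<lambda>w. 0)) (at z within UNIV)" for z
    by (rule has_derivative_eq_rhs[OF has_derivative_diff[OF height_has_derivative[OF s(1,2)]
          has_derivative_inner_right[OF has_derivative_ident]]]) (simp add: const)
  then obtain k where k: "\<And>z. X (s z) \<bullet> y - g \<bullet> z = k"
    using has_derivative_zero_constant[of UNIV "\<lambda>z. X (s z) \<bullet> y - g \<bullet> z"] by auto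
  define m where "m = y - vector [g $ 1 * y $ 2, - g $ 1 * y $ 1, g $ 2]"
  have m: "m \<bullet> v = v \<bullet> y - g \<bullet> Q v" for v
    by (simp add: m_def tproj_def inner_diff_left inner_real2 inner_real3 algebra_simps)
  have "y \<bullet> y = 1" using norm_y by (simp add: norm_eq_1)
  then have "m \<bullet> y = 1" by (simp add: m tproj_def inner_real2 y3)
  then have "m \<noteq> 0" by auto
  have "range X = {v. m \<bullet> v = k}"
  proof (intro equalityI subsetI)
    fix v assume "v \<in> range X"
    then obtain p where "v = X p" by blast
    then show "v \<in> {v. m \<bullet> v = k}" using k[of "F p"] by (simp add: s(3) m)
  next
    fix v assume "v \<in> {v. m \<bullet> v = k}"
    then have "X (s (Q v)) = v" using k[of "Q v"] by (intro decomp_eqI) (simp_all add: s(2) m)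
    then show "v \<in> range X" by (metis rangeI)
  qed
  moreover have "inj X" by (metis s(3) injI)
  ultimately show ?thesis using \<open>m \<noteq> 0\<close> by (simp add: affine_hyperplane aff_dim_hyperplane)
qed

end

text \<open>An immersion might a priori cover its image several times, so being a plane includes
  injectivity of \<open>X\<close> besides a two-dimensional affine image.\<close>

theorem theoremA:
  fixes \<phi> :: "real \<Rightarrow> real"
    and A :: "'m::{t2_space,second_countable_topology} atlas"
    and X N :: "'m \<Rightarrow> real^3"
    and y0 :: "real^3"
    and C \<epsilon> :: real
  assumes "smooth_on UNIV \<phi>"
    and "mono \<phi> \<or> antimono \<phi>"
    and "\<forall>t. deriv (deriv (deriv \<phi>)) t * deriv \<phi> t \<ge> 0"
    and "\<forall>t. deriv (deriv \<phi>) t \<le> 0"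
    and "oriented_immersed_surface A X N"
    and "complete_surface X"
    and "phi_minimal \<phi> A X N"
    and "\<exists>B. \<forall>(U,\<psi>)\<in>A. \<forall>u\<in>U. \<bar>mean_curvature (X \<circ> \<psi>) (N \<circ> \<psi>) u\<bar> \<le> B"
    and "\<forall>(U,\<psi>)\<in>A. \<forall>u\<in>U. gauss_curvature (X \<circ> \<psi>) (N \<circ> \<psi>) u \<ge> 0"
    and "C > 0"
    and "\<exists>R. \<forall>p. norm (X p) \<ge> R \<longrightarrow> (X p \<bullet> e3) * \<bar>deriv \<phi> (X p \<bullet> e3)\<bar> \<le> C * norm (X p)"
    and "\<epsilon> > 0"
    and "norm y0 = 1" and "y0 \<bullet> e3 = 0"
    and "\<forall>p. N p \<bullet> y0 \<le> - 2 * \<epsilon>"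
  shows "inj X \<and> affine (range X) \<and> aff_dim (range X) = 2"
proof -
  interpret steep_surface y0 A X N \<epsilon>
    using assms by unfold_locales auto
  obtain s where s: "continuous_on UNIV s" "\<And>z. F (s z) = z" "\<And>p. s (F p) = p"
    by (rule entire_section) blast
  define a where "a = (\<lambda>z. slope (s z) $ 1)"
  define b where "b = (\<lambda>z. slope (s z) $ 2)"
  define p where "p = (\<lambda>z. curv s z (axis 1 1) $ 1)"
  define q where "q = (\<lambda>z. curv s z (axis 1 1) $ 2)"
  define r where "r = (\<lambda>z. curv s z (axis 2 1) $ 2)"
  have curvature: "q z * q z \<le> p z * r z"
    "(1 + b z * b z) * p z - 2 * a z * b z * q z + (1 + a z * a z) * r z
        = - deriv \<phi> (z $ 2) * b z * (1 + a z * a z + b z * b z)" for z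
  proof -
    obtain U \<psi> u where c: "(U, \<psi>) \<in> A" "u \<in> U" "\<psi> u = s z" by (rule ex_chart)
    define n where "n = N (s z)"
    define W where "W = 1 + a z * a z + b z * b z"
    define H where "H = mean_curvature (X \<circ> \<psi>) (N \<circ> \<psi>) u"
    define K where "K = gauss_curvature (X \<circ> \<psi>) (N \<circ> \<psi>) u"
    have ny: "n \<bullet> y0 \<noteq> 0" using N_y(2) by (simp add: n_def)
    have W: "W > 0" by (simp add: W_def add_pos_nonneg)
    have Fz: "F (\<psi> u) = z" using c(3) s(2) by simp
    have cs: "W * K = (n \<bullet> y0)\<^sup>2 * (p z * r z - q z * q z)"
      "W * H = (n \<bullet> y0) * ((1 + b z * b z) * p z - 2 * a z * b z * q z + (1 + a z * a z) * r z)"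
      using curvature_section[OF s c(1,2)] unfolding Fz
      by (simp_all add: c(3) W_def K_def H_def n_def a_def b_def p_def q_def r_def)
    have "0 \<le> W * K" using assms(9) c W by (auto simp: K_def)
    then show "q z * q z \<le> p z * r z" unfolding cs(1) using ny by (simp add: zero_le_mult_iff)
    \<comment> \<open>The second coordinate of the projection plane is the height, so the weight
      depends on \<open>z $ 2\<close> only.\<close>
    have "X (s z) \<bullet> e3 = z $ 2"
      using arg_cong[OF s(2)[of z], of "\<lambda>v. v $ 2"] by (simp add: tproj_def inner_axis)
    moreover have "mean_curvature_vector (X \<circ> \<psi>) (N \<circ> \<psi>) u = H *\<^sub>R n"
      using mean_curvature_vector_eq[of "N \<circ> \<psi>" u "X \<circ> \<psi>"] norm_N by (simp add: H_def n_def c(3))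
    moreover have "mean_curvature_vector (X \<circ> \<psi>) (N \<circ> \<psi>) u =
        deriv \<phi> (X (\<psi> u) \<bullet> e3) *\<^sub>R normal_part (N (\<psi> u)) e3"
      using assms(7) c(1,2) by (auto simp: phi_minimal_def)
    ultimately have "H *\<^sub>R n = (deriv \<phi> (z $ 2) * n $ 3) *\<^sub>R n"
      by (auto simp: c(3) n_def normal_part_def inner_axis inner_commute)
    moreover have "n \<noteq> 0" using ny by auto
    ultimately have H: "H = deriv \<phi> (z $ 2) * n $ 3" by simp
    \<comment> \<open>The definition of \<open>slope\<close> expresses the vertical part of the
      normal by \<open>b\<close>. This turns the minimality equation
      \<open>H = deriv \<phi> (z $ 2) * n $ 3\<close> into one for the graph function, after
      dividing by \<open>n \<bullet> y0\<close>.\<close>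
    have "n $ 3 = - b z * (n \<bullet> y0)" using ny by (simp add: b_def slope_def n_def tproj_def)
    then have "(n \<bullet> y0) * ((1 + b z * b z) * p z - 2 * a z * b z * q z + (1 + a z * a z) * r z)
        = (n \<bullet> y0) * (- deriv \<phi> (z $ 2) * b z * W)"
      using cs(2) by (simp add: H algebra_simps)
    then show "(1 + b z * b z) * p z - 2 * a z * b z * q z + (1 + a z * a z) * r z
        = - deriv \<phi> (z $ 2) * b z * (1 + a z * a z + b z * b z)"
      using ny unfolding W_def mult_left_cancel[OF ny] by blast
  qed
  note D = smooth_on_real_deriv[OF assms(1)]
  have anti: "antimono (deriv \<phi>)"
  proof (rule antimonoI)
    fix t t' :: real assume "t \<le> t'"
    then show "deriv \<phi> t' \<le> deriv \<phi> t"
      by (rule DERIV_nonpos_imp_nonincreasing) (use D(2) assms(4) in blast)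
  qed
  have sgn: "(\<forall>t. 0 \<le> deriv \<phi> t) \<or> (\<forall>t. deriv \<phi> t \<le> 0)"
    using assms(2)
  proof
    assume "mono \<phi>"
    then have "0 \<le> deriv \<phi> t" for t
      by (intro mono_on_imp_deriv_nonneg[of UNIV \<phi>, OF _ D(1)]) auto
    then show ?thesis by blast
  next
    assume "antimono \<phi>"
    then have "mono (\<lambda>t. - \<phi> t)" by (auto simp: mono_def antimono_def)
    then have "0 \<le> - deriv \<phi> t" for t
      by (intro mono_on_imp_deriv_nonneg[of UNIV "\<lambda>t. - \<phi> t", OF _ DERIV_minus[OF D(1)]]) auto
    then show ?thesis by simp
  qed
  have "slope (s z) = slope (s 0)" for z
  proof (rule bounded_gradient_rigidity[where G = "\<lambda>z. slope (s z)"])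
    show "norm (slope (s z)) \<le> 1 / (2 * \<epsilon>)" for z
      unfolding slope_def by (rule norm_slope_le[OF norm_N steep \<epsilon>])
  qed (fact height_has_derivative[OF s(1,2)] slope_has_derivative[OF s(1,2)] anti sgn
      curvature[unfolded a_def b_def p_def q_def r_def])+
  then show ?thesis by (rule plane_if_slope_constant[OF s])
qed

end
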